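(* For all integers $m\ge 2$ and $t\ge 1$ there is an integer $n_0=n_0(m,t)$ such that for every integer $n\ge n_0$ and every tree $T_n$ on $n$ vertices, $$r_{*}(T_n,tK_m)=(n-1)(m-2)+t.$$
   Context: All graphs are simple. $K_n$ is the complete graph on $n$ vertices, $K_{1,s}$ is the star on $s+1$ vertices, and $tK_m$ is the union of $t$ vertex-disjoint copies of $K_m$. For graphs $H,H_1,H_2$, write $H\rightarrow(H_1,H_2)$ if every coloring of the edges of $H$ with the colors red and blue yields a red copy of $H_1$ (a subgraph isomorphic to $H_1$, all of whose edges are red) or a blue copy of $H_2$. The Ramsey number $r(H_1,H_2)$ is the minimum integer $N$ such that $K_N\rightarrow(H_1,H_2)$. For a subgraph $H$ of $G$, $G-H$ denotes the graph with vertex set $V(G)$ and edge set $E(G)\setminus E(H)$. The star-critical Ramsey number $r_{*}(H_1,H_2)$ is the minimum integer $k$ (with $0\le k\le N-1$) such that $K_N-K_{1,N-1-k}\rightarrow(H_1,H_2)$, where $N=r(H_1,H_2)$. Equivalently, $K_N-K_{1,N-1-k}$ is the graph obtained from $K_{N-1}$ by adding one new vertex adjacent to exactly $k$ vertices of $K_{N-1}$. *)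

theory Defs
  imports "HOL-Library.Ramsey"
begin

text \<open>
  Finite simple graphs are pairs of a vertex set and a set of two-element sets of vertices;
  \<open>nsets A 2\<close> is the set of two-element subsets of \<open>A\<close>.
\<close>

type_synonym 'a graph = "'a set \<times> 'a set set"

abbreviation verts :: "'a graph \<Rightarrow> 'a set" where
  "verts G \<equiv> fst G"

abbreviation edges :: "'a graph \<Rightarrow> 'a set set" where
  "edges G \<equiv> snd G"

definition simple_graph :: "'a graph \<Rightarrow> bool" where
  "simple_graph G \<longleftrightarrow> finite (verts G) \<and> edges G \<subseteq> nsets (verts G) 2"

definition subgraph :: "'a graph \<Rightarrow> 'a graph \<Rightarrow> bool" where
  "subgraph H G \<longleftrightarrow> simple_graph H \<and> verts H \<subseteq> verts G \<and> edges H \<subseteq> edges G"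

definition isomorphic :: "'a graph \<Rightarrow> 'b graph \<Rightarrow> bool" where
  "isomorphic G H \<longleftrightarrow> (\<exists>f. bij_betw f (verts G) (verts H) \<and>
     (\<forall>u\<in>verts G. \<forall>v\<in>verts G. {u, v} \<in> edges G \<longleftrightarrow> {f u, f v} \<in> edges H))"

definition connected_graph :: "'a graph \<Rightarrow> bool" where
  "connected_graph G \<longleftrightarrow> verts G \<noteq> {} \<and>
     (\<forall>u\<in>verts G. \<forall>v\<in>verts G. (u, v) \<in> {(x, y). {x, y} \<in> edges G}\<^sup>*)"

text \<open>A cycle is given by the list of its vertices, without repeating the first one at the end.\<close>

definition cycle :: "'a graph \<Rightarrow> 'a list \<Rightarrow> bool" where
  "cycle G p \<longleftrightarrow> 3 \<le> length p \<and> distinct p \<and>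
     (\<forall>i<length p. {p ! i, p ! (Suc i mod length p)} \<in> edges G)"

definition tree :: "'a graph \<Rightarrow> bool" where
  "tree G \<longleftrightarrow> simple_graph G \<and> connected_graph G \<and> \<not> (\<exists>p. cycle G p)"

definition complete_graph :: "nat \<Rightarrow> nat graph" where
  "complete_graph n = ({..<n}, nsets {..<n} 2)"

text \<open>The star $K_{1,s}$, with centre \<open>0\<close> and leaves \<open>1, \<dots>, s\<close>.\<close>

definition star_graph :: "nat \<Rightarrow> nat graph" where
  "star_graph s = ({..s}, {{0, i} | i. 1 \<le> i \<and> i \<le> s})"

text \<open>The union of \<open>t\<close> vertex-disjoint copies of \<open>G\<close>; copy \<open>i\<close> lives on \<open>{i} \<times> verts G\<close>.\<close>

definition copies :: "nat \<Rightarrow> 'a graph \<Rightarrow> (nat \<times> 'a) graph" where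
  "copies t G = ({..<t} \<times> verts G, \<Union>i<t. (\<lambda>e. Pair i ` e) ` edges G)"

definition remove_edges :: "'a graph \<Rightarrow> 'a graph \<Rightarrow> 'a graph" where
  "remove_edges G H = (verts G, edges G - edges H)"

datatype colour = Red | Blue

text \<open>Colourings are total functions on sets of vertices; only their values on edges matter.\<close>

definition mono_copy :: "'a graph \<Rightarrow> ('a set \<Rightarrow> colour) \<Rightarrow> colour \<Rightarrow> 'b graph \<Rightarrow> bool" where
  "mono_copy G c k H \<longleftrightarrow> (\<exists>S. subgraph S G \<and> isomorphic S H \<and> (\<forall>e\<in>edges S. c e = k))"

definition arrows :: "'a graph \<Rightarrow> 'b graph \<Rightarrow> 'c graph \<Rightarrow> bool" where
  "arrows G H1 H2 \<longleftrightarrow> (\<forall>c. mono_copy G c Red H1 \<or> mono_copy G c Blue H2)"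

definition ramsey_number :: "'a graph \<Rightarrow> 'b graph \<Rightarrow> nat" where
  "ramsey_number H1 H2 = (LEAST N. arrows (complete_graph N) H1 H2)"

text \<open>
  All stars $K_{1,s}$ in $K_N$ are equivalent under automorphisms of $K_N$; the one removed here
  has centre \<open>0\<close>, which keeps \<open>k\<close> neighbours.
\<close>

definition star_critical_ramsey :: "'a graph \<Rightarrow> 'b graph \<Rightarrow> nat" where
  "star_critical_ramsey H1 H2 = (let N = ramsey_number H1 H2 in
     LEAST k. k \<le> N - 1 \<and>
       arrows (remove_edges (complete_graph N) (star_graph (N - 1 - k))) H1 H2)"

end

theory Submission
  imports Defs "HOL-Library.Disjoint_Sets"
begin

text \<open>
  Put \<open>M = m - 1\<close>, \<open>N = (n - 1) * M + t\<close> and \<open>k = (n - 1) * (m - 2) + t\<close>, so that the vertex of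
  reduced degree \<open>k\<close> misses exactly \<open>n - 2\<close> vertices.

  Lower bounds (\<open>not_arrows_critical\<close>): split all but \<open>t - 1\<close> vertices into \<open>M\<close> classes, colour edges
  inside a class red and all others blue. If the special vertex \<open>0\<close> has at least \<open>n - 1\<close> non-neighbours,
  it can join a class of \<open>n - 1\<close> vertices without being adjacent to any of them. Red components then
  have at most \<open>n - 1\<close> vertices, and every blue \<open>K_m\<close> uses one of the \<open>t - 1\<close> extra vertices. This
  gives both \<open>r(T_n, tK_m) \<ge> N\<close> and \<open>r_* \<ge> k\<close>.

  Upper bounds (\<open>tree_or_disjoint_cliques\<close>): let \<open>U\<close> be the \<open>N - 1\<close> vertices of the complete part,
  \<open>v\<close> the additional vertex, and suppose that there is no red \<open>T_n\<close> and no blue \<open>tK_m\<close>. The embedding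
  tool is \<open>near_clique_embeds\<close>: a tree on \<open>n\<close> vertices has a large independent set of vertices of
  degree at most 2, so a bounded set \<open>S\<close> added to a red clique can be used in full, provided that \<open>S\<close> has
  \<open>2 |S|\<close> common red neighbours in the clique.

  After removal of boundedly many vertices \<open>U\<close> contains no blue \<open>K_m\<close>. A stability argument
  (\<open>clique_stability\<close>) then yields disjoint red cliques \<open>A_0, \<dots>, A_(M-1)\<close> of size \<open>n - O(1)\<close>, and only
  boundedly many vertices lie outside them. An outside vertex with few blue neighbours in some \<open>A_j\<close> is
  assigned to it, which gives parts \<open>V_j\<close>; the embedding tool forces \<open>|V_j| \<le> n - 1\<close>. The remaining
  vertices are bad: they have many blue neighbours in every \<open>A_j\<close>, and edges between different \<open>A_j\<close>
  are almost all blue, so disjoint blue \<open>K_m\<close> can be grown greedily from any \<open>t\<close> bad vertices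
  (\<open>seeds_extend\<close>). Hence there are at most \<open>t - 1\<close> of them, and counting makes everything exact:
  there are \<open>t - 1\<close> bad vertices and \<open>|V_j| = n - 1\<close> for all \<open>j\<close>.

  Now any further disjoint seed of a blue \<open>K_m\<close> is contradictory. A blue edge inside \<open>V_j\<close> would be
  such a seed, so each \<open>V_j\<close> is a red clique on \<open>n - 1\<close> vertices. A red edge from \<open>v\<close> to some \<open>V_j\<close> would
  complete a red \<open>T_n\<close> with \<open>v\<close> as a leaf, so all edges from \<open>v\<close> to the parts are blue. As \<open>v\<close> misses
  only \<open>n - 2\<close> vertices, it has a neighbour in every part, and at most one part contains more than half
  of the missed vertices. A blue edge from \<open>v\<close> into the part that it misses most extends to the last
  blue \<open>K_m\<close>.
\<close>

section \<open>Monochromatic copies as injective maps\<close>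

text \<open>
  A copy only has to contain the edges of \<open>H\<close>, not to be induced, so an injective map sending edges to
  edges of colour \<open>k\<close> is all that matters.
\<close>

lemma mono_copy_iff:
  assumes "simple_graph H"
  shows "mono_copy G c k H \<longleftrightarrow> (\<exists>f. inj_on f (verts H) \<and> f ` verts H \<subseteq> verts G \<and>
    (\<forall>u\<in>verts H. \<forall>v\<in>verts H. {u, v} \<in> edges H \<longrightarrow> {f u, f v} \<in> edges G \<and> c {f u, f v} = k))"
    (is "_ \<longleftrightarrow> (\<exists>f. ?P f)")
proof
  assume "mono_copy G c k H"
  then obtain S f where S: "subgraph S G" "\<forall>e\<in>edges S. c e = k"
    and f: "bij_betw f (verts S) (verts H)"
      "\<forall>u\<in>verts S. \<forall>v\<in>verts S. {u, v} \<in> edges S \<longleftrightarrow> {f u, f v} \<in> edges H"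
    unfolding mono_copy_def isomorphic_def by blast
  let ?g = "inv_into (verts S) f"
  have g: "bij_betw ?g (verts H) (verts S)" using f(1) by (rule bij_betw_inv_into)
  have mem: "?g u \<in> verts S" if "u \<in> verts H" for u using g that by (rule bij_betwE[rule_format])
  have fg: "f (?g u) = u" if "u \<in> verts H" for u
    using f(1) that by (simp add: bij_betw_inv_into_right)
  have "{?g u, ?g v} \<in> edges S" if "u \<in> verts H" "v \<in> verts H" "{u, v} \<in> edges H" for u v
    using f(2) mem fg that by auto
  then have "?P ?g"
    using g S mem unfolding subgraph_def bij_betw_def by blast
  then show "\<exists>f. ?P f" by (intro exI[of _ ?g])
next
  assume "\<exists>f. ?P f"
  then obtain f where "?P f" ..
  then have inj: "inj_on f (verts H)" and im: "f ` verts H \<subseteq> verts G"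
    and e: "\<And>u v. u \<in> verts H \<Longrightarrow> v \<in> verts H \<Longrightarrow> {u, v} \<in> edges H \<Longrightarrow>
      {f u, f v} \<in> edges G \<and> c {f u, f v} = k" by auto
  have H: "finite (verts H)" "edges H \<subseteq> nsets (verts H) 2"
    using assms by (auto simp: simple_graph_def)
  have ed: "\<exists>u\<in>verts H. \<exists>v\<in>verts H. u \<noteq> v \<and> e = {u, v}" if "e \<in> edges H" for e
    using H(2) that unfolding nsets_2_eq by fastforce
  define S where "S = (f ` verts H, (`) f ` edges H)"
  have 1: "d \<in> edges G \<and> c d = k \<and> d \<in> nsets (verts S) 2" if d: "d \<in> edges S" for d
  proof -
    obtain d' where d': "d' \<in> edges H" "d = f ` d'" using d by (auto simp: S_def)
    then obtain u v where uv: "u \<in> verts H" "v \<in> verts H" "u \<noteq> v" "d' = {u, v}" using ed by blast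
    then have "f u \<noteq> f v" using inj by (auto dest: inj_onD)
    then show ?thesis using e[OF uv(1,2)] uv d' by (auto simp: nsets_2_eq S_def)
  qed
  have inj2: "{f u, f v} \<in> edges S \<longleftrightarrow> {u, v} \<in> edges H" if "u \<in> verts H" "v \<in> verts H" for u v
  proof
    assume "{f u, f v} \<in> edges S"
    then obtain d where d: "d \<in> edges H" "f ` {u, v} = f ` d" by (auto simp: S_def)
    have "d \<subseteq> verts H" using ed[OF d(1)] by auto
    then have "{u, v} = d" using inj_on_image_eq_iff[OF inj, of "{u, v}" d] d(2) that by simp
    then show "{u, v} \<in> edges H" using d by simp
  next
    assume "{u, v} \<in> edges H"
    then have "f ` {u, v} \<in> edges S" unfolding S_def snd_conv by (rule imageI)
    then show "{f u, f v} \<in> edges S" by simp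
  qed
  let ?g = "inv_into (verts H) f"
  have g: "?g (f u) = u" if "u \<in> verts H" for u using inj that by simp
  have "isomorphic S H" unfolding isomorphic_def
  proof (intro exI conjI)
    show "bij_betw ?g (verts S) (verts H)"
      using inj by (simp add: S_def bij_betw_inv_into inj_on_imp_bij_betw)
    show "\<forall>u\<in>verts S. \<forall>v\<in>verts S. ({u, v} \<in> edges S) = ({?g u, ?g v} \<in> edges H)"
      using inj2 g by (auto simp: S_def)
  qed
  moreover have "subgraph S G"
    using 1 im H(1) unfolding subgraph_def simple_graph_def by (auto simp: S_def)
  ultimately show "mono_copy G c k H" using 1 unfolding mono_copy_def by (intro exI[of _ S]) simp
qed

text \<open>
  Colourings are pulled back along \<open>h\<close>.
\<close>

lemma mono_copy_embed:
  assumes H: "simple_graph H" and m: "mono_copy G (\<lambda>e. c (h ` e)) k H"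
    and h: "inj_on h (verts G)" "h ` verts G \<subseteq> verts G'"
    and e: "\<And>u v. u \<in> verts G \<Longrightarrow> v \<in> verts G \<Longrightarrow> {u, v} \<in> edges G \<Longrightarrow> {h u, h v} \<in> edges G'"
  shows "mono_copy G' c k H"
proof -
  obtain f where "inj_on f (verts H) \<and> f ` verts H \<subseteq> verts G \<and>
    (\<forall>u\<in>verts H. \<forall>v\<in>verts H. {u, v} \<in> edges H \<longrightarrow> {f u, f v} \<in> edges G \<and> c (h ` {f u, f v}) = k)"
    using m unfolding mono_copy_iff[OF H] by (elim exE)
  then have f: "inj_on f (verts H)" "f ` verts H \<subseteq> verts G"
    "\<And>u v. u \<in> verts H \<Longrightarrow> v \<in> verts H \<Longrightarrow> {u, v} \<in> edges H \<Longrightarrow>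
      {f u, f v} \<in> edges G \<and> c (h ` {f u, f v}) = k"
    by simp_all
  show ?thesis unfolding mono_copy_iff[OF H]
  proof (intro exI[of _ "h \<circ> f"] conjI ballI impI)
    show "inj_on (h \<circ> f) (verts H)" using f h by (meson comp_inj_on inj_on_subset)
    show "(h \<circ> f) ` verts H \<subseteq> verts G'" using f h by (auto simp: image_subset_iff)
    fix u v assume uv: "u \<in> verts H" "v \<in> verts H" "{u, v} \<in> edges H"
    then show "{(h \<circ> f) u, (h \<circ> f) v} \<in> edges G'" "c {(h \<circ> f) u, (h \<circ> f) v} = k"
      using f(2) f(3)[OF uv] e by (auto simp: image_subset_iff)
  qed
qed

lemma arrows_embed:
  assumes arr: "arrows G H1 H2" and H: "simple_graph H1" "simple_graph H2"
    and h: "inj_on h (verts G)" "h ` verts G \<subseteq> verts G'"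
    and e: "\<And>u v. u \<in> verts G \<Longrightarrow> v \<in> verts G \<Longrightarrow> {u, v} \<in> edges G \<Longrightarrow> {h u, h v} \<in> edges G'"
  shows "arrows G' H1 H2"
  unfolding arrows_def
proof
  fix c
  from arr have "mono_copy G (\<lambda>e. c (h ` e)) Red H1 \<or> mono_copy G (\<lambda>e. c (h ` e)) Blue H2"
    unfolding arrows_def by (rule spec)
  then show "mono_copy G' c Red H1 \<or> mono_copy G' c Blue H2"
    using mono_copy_embed[OF H(1) _ h e] mono_copy_embed[OF H(2) _ h e] by auto
qed

lemma edges_copies_complete:
  "{u, v} \<in> edges (copies t (complete_graph m)) \<longleftrightarrow>
   u \<noteq> v \<and> fst u = fst v \<and> fst u < t \<and> snd u < m \<and> snd v < m"
proof
  assume "{u, v} \<in> edges (copies t (complete_graph m))"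
  then obtain i e where i: "i < t" "e \<in> nsets {..<m} 2" "{u, v} = Pair i ` e"
    by (auto simp: copies_def complete_graph_def)
  then obtain x y where "x < m" "y < m" "x \<noteq> y" "e = {x, y}"
    unfolding nsets_2_eq by blast
  with i have "i < t" "{u, v} = {(i, x), (i, y)}" "x < m" "y < m" "x \<noteq> y" by auto
  then show "u \<noteq> v \<and> fst u = fst v \<and> fst u < t \<and> snd u < m \<and> snd v < m"
    by (auto simp: doubleton_eq_iff)
next
  assume *: "u \<noteq> v \<and> fst u = fst v \<and> fst u < t \<and> snd u < m \<and> snd v < m"
  then have ne: "snd u \<noteq> snd v" by (auto simp: prod_eq_iff)
  have "(fst u, snd u) = u" "(fst u, snd v) = v" using * by (auto simp: prod_eq_iff)
  then have "{u, v} = Pair (fst u) ` {snd u, snd v}" by auto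
  moreover have "{snd u, snd v} \<in> nsets {..<m} 2"
    using * ne by (auto simp: nsets_def)
  ultimately have "{u, v} \<in> (\<lambda>e. Pair (fst u) ` e) ` nsets {..<m} 2" by (rule image_eqI)
  then show "{u, v} \<in> edges (copies t (complete_graph m))"
    unfolding copies_def complete_graph_def snd_conv using * by (intro UN_I[of "fst u"]) simp_all
qed

lemma verts_copies_complete: "verts (copies t (complete_graph m)) = {..<t} \<times> {..<m}"
  by (simp add: copies_def complete_graph_def)

lemma simple_copies_complete: "simple_graph (copies t (complete_graph m))"
  unfolding simple_graph_def
proof
  show "finite (verts (copies t (complete_graph m)))" by (simp add: verts_copies_complete)
  show "edges (copies t (complete_graph m)) \<subseteq> [verts (copies t (complete_graph m))]\<^bsup>2\<^esup>"
  proof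
    fix e assume "e \<in> edges (copies t (complete_graph m))"
    then obtain i d where i: "i < t" "d \<in> nsets {..<m} 2" "e = Pair i ` d"
      by (auto simp: copies_def complete_graph_def)
    then obtain x y where "x < m" "y < m" "x \<noteq> y" "d = {x, y}"
      unfolding nsets_2_eq by blast
    with i have "i < t" "e = {(i, x), (i, y)}" "x < m" "y < m" "x \<noteq> y" by auto
    then show "e \<in> [verts (copies t (complete_graph m))]\<^bsup>2\<^esup>"
      unfolding verts_copies_complete nsets_2_eq by blast
  qed
qed

section \<open>Trees as parent functions\<close>

text \<open>
  A tree is encoded by numbering its vertices \<open>0, \<dots>, n - 1\<close> such that every vertex \<open>i > 0\<close> has
  exactly one neighbour \<open>p i\<close> among its predecessors.
\<close>

definition parent_edge :: "(nat \<Rightarrow> nat) \<Rightarrow> nat \<Rightarrow> nat \<Rightarrow> bool" where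
  "parent_edge p i j \<longleftrightarrow> 0 < i \<and> p i = j \<or> 0 < j \<and> p j = i"

definition parent_fun :: "(nat \<Rightarrow> nat) \<Rightarrow> nat \<Rightarrow> bool" where
  "parent_fun p n \<longleftrightarrow> (\<forall>i. 0 < i \<and> i < n \<longrightarrow> p i < i)"

definition embeds :: "(nat \<Rightarrow> nat) \<Rightarrow> nat \<Rightarrow> ('v \<Rightarrow> 'v \<Rightarrow> bool) \<Rightarrow> 'v set \<Rightarrow> bool" where
  "embeds p n r U \<longleftrightarrow> (\<exists>\<phi>. inj_on \<phi> {..<n} \<and> \<phi> ` {..<n} \<subseteq> U \<and>
     (\<forall>i. 0 < i \<and> i < n \<longrightarrow> r (\<phi> i) (\<phi> (p i))))"

text \<open>
  Joined by a path with no repeated vertex inside \<open>D\<close>. Such paths, given as lists, are what turns two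
  edges into the same connected set into a \<^const>\<open>cycle\<close>.
\<close>

definition joined :: "'a set set \<Rightarrow> 'a set \<Rightarrow> 'a \<Rightarrow> 'a \<Rightarrow> bool" where
  "joined E D x y \<longleftrightarrow> (\<exists>xs. xs \<noteq> [] \<and> distinct xs \<and> set xs \<subseteq> D \<and> hd xs = x \<and> last xs = y \<and>
     successively (\<lambda>a b. {a, b} \<in> E) xs)"

lemma joinedI:
  "xs \<noteq> [] \<Longrightarrow> distinct xs \<Longrightarrow> set xs \<subseteq> D \<Longrightarrow> hd xs = x \<Longrightarrow> last xs = y \<Longrightarrow>
     successively (\<lambda>a b. {a, b} \<in> E) xs \<Longrightarrow> joined E D x y"
  unfolding joined_def by (intro exI[of _ xs] conjI)

lemma joinedE:
  assumes "joined E D x y"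
  obtains xs where "xs \<noteq> []" "distinct xs" "set xs \<subseteq> D" "hd xs = x" "last xs = y"
     "successively (\<lambda>a b. {a, b} \<in> E) xs"
  using assms unfolding joined_def by (elim exE conjE)

lemma joined_sym: "joined E D x y \<Longrightarrow> joined E D y x"
  by (elim joinedE, rule_tac xs = "rev xs" in joinedI)
     (auto simp: hd_rev last_rev successively_rev insert_commute)

text \<open>
  The numbering is built one vertex at a time. By connectedness some edge leaves the set \<open>D\<close> of
  numbered vertices. Its outer end \<open>x\<close> has only one neighbour in \<open>D\<close>: two of them, together with a path
  between them inside \<open>D\<close>, would form a cycle through \<open>x\<close>. The last conjunct keeps the paths available.
\<close>

lemma tree_partial_order:
  assumes T: "tree T"
  shows "k \<le> card (verts T) \<Longrightarrow> 1 \<le> k \<Longrightarrow> \<exists>g p. inj_on g {..<k} \<and> g ` {..<k} \<subseteq> verts T \<and> parent_fun p k \<and>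
    (\<forall>i<k. \<forall>j<k. {g i, g j} \<in> edges T \<longleftrightarrow> parent_edge p i j) \<and>
    (\<forall>x \<in> g ` {..<k}. \<forall>y \<in> g ` {..<k}. joined (edges T) (g ` {..<k}) x y)"
proof (induction k)
  case 0 then show ?case by simp
next
  case (Suc k)
  have simp: "simple_graph T" and conn: "connected_graph T" and nocyc: "\<not> cycle T xs" for xs
    using T by (auto simp: tree_def)
  have loop: "{x} \<notin> edges T" for x using simp by (auto simp: simple_graph_def nsets_def)
  show ?case
  proof (cases "k = 0")
    case True
    obtain x where "x \<in> verts T" using conn by (auto simp: connected_graph_def)
    with True loop show ?thesis
      by (intro exI[of _ "\<lambda>_. x"] exI[of _ "\<lambda>_. 0"])
        (auto simp: parent_fun_def parent_edge_def inj_on_def intro!: joinedI[of "[x]"])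
  next
    case False
    have "k \<le> card (verts T)" "1 \<le> k" using Suc.prems False by auto
    from Suc.IH[OF this] obtain g p where
      "inj_on g {..<k} \<and> g ` {..<k} \<subseteq> verts T \<and> parent_fun p k \<and>
       (\<forall>i<k. \<forall>j<k. {g i, g j} \<in> edges T \<longleftrightarrow> parent_edge p i j) \<and>
       (\<forall>x \<in> g ` {..<k}. \<forall>y \<in> g ` {..<k}. joined (edges T) (g ` {..<k}) x y)"
      by (elim exE)
    then have g: "inj_on g {..<k}" "g ` {..<k} \<subseteq> verts T" and p: "parent_fun p k"
      and e: "\<And>i j. i < k \<Longrightarrow> j < k \<Longrightarrow> {g i, g j} \<in> edges T \<longleftrightarrow> parent_edge p i j"
      and path: "\<And>i j. i < k \<Longrightarrow> j < k \<Longrightarrow> joined (edges T) (g ` {..<k}) (g i) (g j)"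
      by auto
    let ?D = "g ` {..<k}"
    have "card ?D = k" using g by (simp add: card_image)
    then have "?D \<noteq> verts T" using Suc.prems by auto
    then obtain z where z: "z \<in> verts T" "z \<notin> ?D" using g by auto
    have "\<exists>y\<in>?D. \<exists>x. x \<notin> ?D \<and> {y, x} \<in> edges T"
    proof (rule ccontr)
      assume no: "\<not> (\<exists>y\<in>?D. \<exists>x. x \<notin> ?D \<and> {y, x} \<in> edges T)"
      have "(g 0, z) \<in> {(x, y). {x, y} \<in> edges T}\<^sup>*"
        using conn z g False by (auto simp: connected_graph_def image_subset_iff)
      then have "z \<in> ?D"
        by (induction rule: rtrancl_induct) (use no False in auto)
      then show False using z by simp
    qed
    then obtain i0 x where i0: "i0 < k" and x: "x \<notin> ?D" "{g i0, x} \<in> edges T" by auto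
    have xV: "x \<in> verts T" using x simp by (auto simp: simple_graph_def nsets_2_eq doubleton_eq_iff)
    have uniq: "j = i0" if j: "j < k" "{g j, x} \<in> edges T" for j
    proof (rule ccontr)
      assume "j \<noteq> i0"
      then have ne: "g j \<noteq> g i0" using g(1) j i0 by (auto simp: inj_on_def)
      obtain xs where xs: "xs \<noteq> []" "distinct xs" "set xs \<subseteq> ?D" "hd xs = g j" "last xs = g i0"
        "successively (\<lambda>a b. {a, b} \<in> edges T) xs" using path[OF j(1) i0] by (rule joinedE)
      have len: "length xs \<ge> 2" using xs ne by (cases xs; cases "tl xs") auto
      have "cycle T (x # xs)" unfolding cycle_def
      proof (intro conjI allI impI)
        show "3 \<le> length (x # xs)" using len by simp
        show "distinct (x # xs)" using xs x by auto
        fix i assume i: "i < length (x # xs)"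
        consider "i = 0" | "i = length xs" | i' where "i = Suc i'" "Suc i' < length xs"
          using i by (cases i) (auto simp: less_Suc_eq)
        then show "{(x # xs) ! i, (x # xs) ! (Suc i mod length (x # xs))} \<in> edges T"
        proof cases
          case 1 then show ?thesis using j xs len by (cases xs) (auto simp: insert_commute)
        next
          case 2 then show ?thesis using x xs by (auto simp: last_conv_nth)
        next
          case 3 then show ?thesis using xs(6) by (auto simp: successively_conv_nth)
        qed
      qed
      then show False using nocyc by blast
    qed
    define g' where "g' = g(k := x)"
    define p' where "p' = p(k := i0)"
    have g'D: "g' ` {..<Suc k} = insert x ?D" by (auto simp: g'_def lessThan_Suc)
    have "inj_on g' {..<Suc k}" using g(1) x(1) by (auto simp: g'_def inj_on_def less_Suc_eq)
    moreover have "g' ` {..<Suc k} \<subseteq> verts T" using g'D g xV by auto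
    moreover have "parent_fun p' (Suc k)" using p i0 by (auto simp: parent_fun_def p'_def less_Suc_eq)
    moreover have "\<forall>i<Suc k. \<forall>j<Suc k. {g' i, g' j} \<in> edges T \<longleftrightarrow> parent_edge p' i j"
    proof (intro allI impI)
      fix i j assume ij: "i < Suc k" "j < Suc k"
      have pk: "p l \<noteq> k" if "0 < l" "l < k" for l using p that by (auto simp: parent_fun_def)
      have *: "{g l, x} \<in> edges T \<longleftrightarrow> l = i0" if "l < k" for l using uniq x(2) that by auto
      consider "i < k" "j < k" | "i = k" "j < k" | "i < k" "j = k" | "i = k" "j = k"
        using ij by linarith
      then show "{g' i, g' j} \<in> edges T \<longleftrightarrow> parent_edge p' i j"
      proof cases
        case 1 then show ?thesis using e by (auto simp: g'_def p'_def parent_edge_def)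
      next
        case 2 then show ?thesis using *[of j] pk False by (auto simp: g'_def p'_def parent_edge_def insert_commute)
      next
        case 3 then show ?thesis using *[of i] pk False by (auto simp: g'_def p'_def parent_edge_def)
      next
        case 4 then show ?thesis using loop i0 by (auto simp: g'_def p'_def parent_edge_def)
      qed
    qed
    moreover have "\<forall>a \<in> g' ` {..<Suc k}. \<forall>b \<in> g' ` {..<Suc k}. joined (edges T) (g' ` {..<Suc k}) a b"
      unfolding g'D
    proof (intro ballI)
      fix a b assume ab: "a \<in> insert x ?D" "b \<in> insert x ?D"
      have fromx: "joined (edges T) (insert x ?D) x (g j)" if j: "j < k" for j
      proof -
        obtain xs where "xs \<noteq> []" "distinct xs" "set xs \<subseteq> ?D" "hd xs = g i0" "last xs = g j"
          "successively (\<lambda>a b. {a, b} \<in> edges T) xs" using path[OF i0 j] by (rule joinedE)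
        then show ?thesis using x
          by (intro joinedI[of "x # xs"]) (auto simp: successively_Cons insert_commute)
      qed
      have mono: "joined (edges T) (insert x ?D) (g i) (g j)" if "i < k" "j < k" for i j
        using path[OF that] by (elim joinedE, rule_tac xs = xs in joinedI) auto
      have "joined (edges T) (insert x ?D) x x" by (rule joinedI[of "[x]"]) auto
      then show "joined (edges T) (insert x ?D) a b"
        using ab fromx mono joined_sym[OF fromx] by auto
    qed
    ultimately show ?thesis by (intro exI[of _ g'] exI[of _ p'] conjI)
  qed
qed

lemma tree_parent_fun:
  assumes "tree T" "card (verts T) = n" "1 \<le> n"
  obtains g p where "bij_betw g {..<n} (verts T)" "parent_fun p n"
    "\<And>i j. i < n \<Longrightarrow> j < n \<Longrightarrow> {g i, g j} \<in> edges T \<longleftrightarrow> parent_edge p i j"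
proof -
  obtain g p where
      "inj_on g {..<n} \<and> g ` {..<n} \<subseteq> verts T \<and> parent_fun p n \<and>
       (\<forall>i<n. \<forall>j<n. {g i, g j} \<in> edges T \<longleftrightarrow> parent_edge p i j) \<and>
       (\<forall>x \<in> g ` {..<n}. \<forall>y \<in> g ` {..<n}. joined (edges T) (g ` {..<n}) x y)"
    using tree_partial_order[OF assms(1) eq_refl[OF assms(2)[symmetric]] assms(3)] by (elim exE)
  then have g: "inj_on g {..<n}" "g ` {..<n} \<subseteq> verts T" "parent_fun p n"
    "\<And>i j. i < n \<Longrightarrow> j < n \<Longrightarrow> {g i, g j} \<in> edges T \<longleftrightarrow> parent_edge p i j"
    by auto
  have "finite (verts T)" using assms(1) by (auto simp: tree_def simple_graph_def)
  then have "bij_betw g {..<n} (verts T)"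
    using g(1,2) assms(2) by (metis bij_betw_def card_image card_lessThan card_subset_eq)
  then show ?thesis using g(3,4) by (rule that)
qed

section \<open>Embedding trees into near-cliques\<close>

lemma embeds_mono: "embeds p n r U \<Longrightarrow> U \<subseteq> U' \<Longrightarrow> embeds p n r U'"
  unfolding embeds_def by blast

text \<open>
  Greedy choice: every chosen vertex rules out itself and at most \<open>d\<close> others.
\<close>

lemma bounded_degree_independent:
  assumes "finite L" "symp E" "\<And>x. x \<in> L \<Longrightarrow> finite {y. E x y} \<and> card {y. E x y} \<le> d"
    and "k * (d + 1) \<le> card L"
  shows "\<exists>I\<subseteq>L. card I = k \<and> (\<forall>x\<in>I. \<forall>y\<in>I. x \<noteq> y \<longrightarrow> \<not> E x y)"
  using assms
proof (induction k arbitrary: L)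
  case 0 then show ?case by (intro exI[of _ "{}"]) auto
next
  case (Suc k)
  then have "L \<noteq> {}" by auto
  then obtain x where x: "x \<in> L" by auto
  let ?L = "L - insert x {y. E x y}"
  have "card (insert x {y. E x y}) \<le> d + 1"
    using Suc.prems(3)[OF x] by (simp add: card_insert_if)
  then have "k * (d + 1) \<le> card ?L"
    using Suc.prems(1,4) diff_card_le_card_Diff[of "insert x {y. E x y}" L] Suc.prems(3)[OF x] by auto
  then obtain I where I: "I \<subseteq> ?L" "card I = k" "\<forall>x\<in>I. \<forall>y\<in>I. x \<noteq> y \<longrightarrow> \<not> E x y"
    using Suc.IH[of ?L] Suc.prems by auto
  have "finite I" using I(1) Suc.prems(1) by (meson finite_Diff finite_subset)
  moreover have "x \<notin> I" using I by auto
  moreover have "\<not> E x y" "\<not> E y x" if "y \<in> I" for y using I(1) that Suc.prems(2) by (auto dest: sympD)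
  ultimately show ?case using I x by (intro exI[of _ "insert x I"]) auto
qed

text \<open>
  There are fewer than \<open>n\<close> parent edges, so at least half of the vertices have at most one child, hence
  degree at most 2. Among them an independent set of a third of the size exists, and its neighbourhood
  has at most \<open>2 * s\<close> vertices.
\<close>

lemma tree_independent_set:
  assumes p: "parent_fun p n" and n: "6 * s \<le> n"
  shows "\<exists>I\<subseteq>{..<n}. card I = s \<and> (\<forall>i\<in>I. \<forall>j\<in>I. \<not> parent_edge p i j) \<and>
    card {j\<in>{..<n}. \<exists>i\<in>I. parent_edge p i j} \<le> 2 * s"
proof (cases "n = 0")
  case True then show ?thesis using n by (intro exI[of _ "{}"]) auto
next
  case False
  define ch where "ch i = {j. 0 < j \<and> j < n \<and> p j = i}" for i
  define L where "L = {i\<in>{..<n}. card (ch i) \<le> 1}"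
  have fch: "finite (ch i)" for i by (simp add: ch_def)
  have "(\<Sum>i<n. card (ch i)) = card (\<Union>i<n. ch i)"
    by (rule card_UN_disjoint[symmetric]) (auto simp: ch_def)
  also have "\<dots> \<le> card {1..<n}" by (intro card_mono) (auto simp: ch_def)
  finally have tot: "(\<Sum>i<n. card (ch i)) \<le> n - 1" by simp
  have "2 * card ({..<n} - L) = (\<Sum>i\<in>{..<n} - L. 2)" by simp
  also have "\<dots> \<le> (\<Sum>i\<in>{..<n} - L. card (ch i))" by (intro sum_mono) (auto simp: L_def)
  also have "\<dots> \<le> (\<Sum>i<n. card (ch i))" by (intro sum_mono2) auto
  finally have "2 * card ({..<n} - L) \<le> n - 1" using tot by simp
  moreover have "card ({..<n} - L) = n - card L" "card L \<le> n"
    using card_Diff_subset[of L "{..<n}"] card_mono[of "{..<n}" L] by (auto simp: L_def)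
  ultimately have cL: "n \<le> 2 * card L" using False by linarith
  define E where "E i j \<longleftrightarrow> i < n \<and> j < n \<and> parent_edge p i j" for i j
  have nb: "finite {j. E i j} \<and> card {j. E i j} \<le> 2" if "i \<in> L" for i
  proof -
    have sub: "{j. E i j} \<subseteq> insert (p i) (ch i)" by (auto simp: E_def parent_edge_def ch_def)
    have "card (insert (p i) (ch i)) \<le> 2" using that fch[of i] by (auto simp: L_def card_insert_if)
    then show ?thesis using card_mono[OF _ sub] finite_subset[OF sub] fch[of i] by fastforce
  qed
  have "symp E" by (auto simp: symp_def E_def parent_edge_def)
  then obtain I where I: "I \<subseteq> L" "card I = s" "\<forall>x\<in>I. \<forall>y\<in>I. x \<noteq> y \<longrightarrow> \<not> E x y"
    using bounded_degree_independent[of L E 2 s] nb n cL by (auto simp: L_def)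
  have IN: "I \<subseteq> {..<n}" using I by (auto simp: L_def)
  have irr: "\<not> parent_edge p i i" if "i < n" for i
    using p that by (auto simp: parent_edge_def parent_fun_def)
  have "{j\<in>{..<n}. \<exists>i\<in>I. parent_edge p i j} = (\<Union>i\<in>I. {j. E i j})"
    using IN by (auto simp: E_def)
  moreover have "card (\<Union>i\<in>I. {j. E i j}) \<le> (\<Sum>i\<in>I. card {j. E i j})"
    using IN by (intro card_UN_le) (auto intro: finite_subset)
  moreover have "\<dots> \<le> (\<Sum>i\<in>I. 2)" using nb I by (intro sum_mono) auto
  ultimately have "card {j\<in>{..<n}. \<exists>i\<in>I. parent_edge p i j} \<le> 2 * s" using I(2) by simp
  moreover have "\<forall>i\<in>I. \<forall>j\<in>I. \<not> parent_edge p i j"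
    using I(3) IN irr unfolding E_def by (metis lessThan_iff subsetD)
  ultimately show ?thesis using I IN by (intro exI[of _ I]) auto
qed

lemma inj_into:
  assumes "finite A" "finite B" "card A \<le> card B"
  obtains f where "inj_on f A" "f ` A \<subseteq> B"
  using card_le_inj[OF assms] by blast

text \<open>
  The vertices of \<open>S\<close> may have arbitrary blue edges among themselves and to \<open>V - S - Q\<close>. They receive an
  independent set \<open>I\<close> of tree vertices of degree at most 2; the at most \<open>2 * card S\<close> neighbours of \<open>I\<close>
  are placed in \<open>Q\<close>, and the rest of the tree anywhere in the clique.
\<close>

lemma near_clique_embeds:
  assumes p: "parent_fun p n" and V: "finite V" "n \<le> card V"
    and S: "S \<subseteq> V" "6 * card S \<le> n" and Q: "Q \<subseteq> V - S" "2 * card S \<le> card Q"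
    and clq: "pairwise r (V - S)" and SQ: "\<And>x q. x \<in> S \<Longrightarrow> q \<in> Q \<Longrightarrow> r x q \<and> r q x"
  shows "embeds p n r V"
proof -
  obtain I where I: "I \<subseteq> {..<n}" "card I = card S" "\<forall>i\<in>I. \<forall>j\<in>I. \<not> parent_edge p i j"
    "card {j\<in>{..<n}. \<exists>i\<in>I. parent_edge p i j} \<le> 2 * card S"
    using tree_independent_set[OF p S(2)] by blast
  define N where "N = {j\<in>{..<n}. \<exists>i\<in>I. parent_edge p i j}"
  have fin: "finite S" "finite Q" "finite I" "finite N"
    using V S Q I by (auto simp: N_def intro: finite_subset)
  have IN: "I \<inter> N = {}" using I(3) by (auto simp: N_def)
  obtain f where f: "inj_on f I" "f ` I \<subseteq> S" using inj_into[OF fin(3,1)] I(2) by auto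
  obtain g where g: "inj_on g N" "g ` N \<subseteq> Q" using inj_into[OF fin(4,2)] I(4) Q(2) by (auto simp: N_def)
  let ?R = "{..<n} - I - N"
  have cR: "card ?R = n - card S - card N"
    using I IN fin by (subst card_Diff_subset) (auto simp: card_Diff_subset N_def)
  have "card (V - S - g ` N) = card V - card S - card N"
    using V S g Q fin by (subst card_Diff_subset) (auto simp: card_Diff_subset card_image)
  then have "card ?R \<le> card (V - S - g ` N)" using cR V(2) by linarith
  then obtain h where h: "inj_on h ?R" "h ` ?R \<subseteq> V - S - g ` N"
    using inj_into[of ?R "V - S - g ` N"] V(1) by blast
  define \<phi> where "\<phi> i = (if i \<in> I then f i else if i \<in> N then g i else h i)" for i
  have pI: "i \<in> I \<Longrightarrow> \<phi> i \<in> S" and pN: "i \<in> N \<Longrightarrow> \<phi> i \<in> Q" for i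
    using f g IN by (auto simp: \<phi>_def)
  have pR: "\<phi> i \<in> V - S - g ` N" if "i < n" "i \<notin> I" "i \<notin> N" for i using that h by (auto simp: \<phi>_def)
  have pnI: "\<phi> i \<in> V - S" if "i < n" "i \<notin> I" for i using that pR pN Q by blast
  have inj: "i = j" if ij: "i < n" "j < n" "\<phi> i = \<phi> j" for i j
  proof -
    consider "i \<in> I" "j \<in> I" | "i \<in> I" "j \<notin> I" | "i \<notin> I" "j \<in> I" | "i \<in> N" "j \<in> N" "i \<notin> I" "j \<notin> I"
      | "i \<notin> I" "j \<notin> I" "i \<in> N" "j \<notin> N" | "i \<notin> I" "j \<notin> I" "i \<notin> N" "j \<in> N"
      | "i \<notin> I" "j \<notin> I" "i \<notin> N" "j \<notin> N" by blast
    then show ?thesis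
    proof cases
      case 1 then show ?thesis using f(1) ij by (auto simp: \<phi>_def inj_on_def)
    next
      case 2 then show ?thesis using pI[of i] pnI[of j] ij by auto
    next
      case 3 then show ?thesis using pI[of j] pnI[of i] ij by auto
    next
      case 4 then show ?thesis using g(1) ij by (auto simp: \<phi>_def inj_on_def)
    next
      case 5 then have "\<phi> i \<in> g ` N" by (simp add: \<phi>_def)
      then show ?thesis using 5 pR[of j] ij by auto
    next
      case 6 then have "\<phi> j \<in> g ` N" by (simp add: \<phi>_def)
      then show ?thesis using 6 pR[of i] ij by auto
    next
      case 7 then have "h i = h j" "i \<in> ?R" "j \<in> ?R" using ij by (auto simp: \<phi>_def)
      then show ?thesis using h(1) by (auto dest: inj_onD)
    qed
  qed
  have "r (\<phi> i) (\<phi> (p i))" if i: "0 < i" "i < n" for i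
  proof -
    have pi: "p i < i" using p i by (auto simp: parent_fun_def)
    have ne: "\<phi> i \<noteq> \<phi> (p i)" using inj[of i "p i"] pi i by auto
    have pe: "parent_edge p i (p i)" "parent_edge p (p i) i" using i by (auto simp: parent_edge_def)
    consider "i \<in> I" | "p i \<in> I" | "i \<notin> I" "p i \<notin> I" by blast
    then show ?thesis
    proof cases
      case 1
      then have "p i \<in> N" using pe pi i by (auto simp: N_def)
      then show ?thesis using 1 pI pN SQ by blast
    next
      case 2
      then have "i \<in> N" using pe i by (auto simp: N_def)
      then show ?thesis using 2 pI pN SQ by blast
    next
      case 3
      then show ?thesis using pnI[of i] pnI[of "p i"] pi i ne clq by (auto simp: pairwise_def)
    qed
  qed
  moreover have "\<phi> ` {..<n} \<subseteq> V" using pI pnI S by blast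
  moreover have "inj_on \<phi> {..<n}" using inj by (auto simp: inj_on_def)
  ultimately show ?thesis unfolding embeds_def by (intro exI[of _ \<phi>]) blast
qed

lemma clique_embeds:
  assumes "parent_fun p n" "finite V" "n \<le> card V" "pairwise r V"
  shows "embeds p n r V"
  using near_clique_embeds[of p n V "{}" "{}" r] assms by simp

text \<open>
  The vertex \<open>n - 1\<close> of the tree is a leaf. It is placed on \<open>v\<close>, its parent on \<open>w\<close>.
\<close>

lemma clique_pendant_embeds:
  assumes p: "parent_fun p n" and n: "2 \<le> n" and A: "finite A" "n - 1 \<le> card A" "pairwise r A"
    and v: "v \<notin> A" "w \<in> A" "r v w"
  shows "embeds p n r (insert v A)"
proof -
  let ?k = "p (n - 1)"
  have k: "?k < n - 1" using p n by (auto simp: parent_fun_def)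
  have "card ({..<n - 1} - {?k}) \<le> card (A - {w})" using A v k by simp
  then obtain h where h: "inj_on h ({..<n - 1} - {?k})" "h ` ({..<n - 1} - {?k}) \<subseteq> A - {w}"
    using inj_into[of "{..<n - 1} - {?k}" "A - {w}"] A(1) by blast
  define \<phi> where "\<phi> = (h(?k := w))(n - 1 := v)"
  have in1: "\<phi> i \<in> A" if "i < n - 1" for i using that h v by (auto simp: \<phi>_def)
  have top: "\<phi> (n - 1) = v" "\<phi> ?k = w" using k by (auto simp: \<phi>_def)
  have inj1: "inj_on \<phi> {..<n - 1}"
    using h k by (fastforce simp: \<phi>_def inj_on_def)
  have N: "{..<n} = insert (n - 1) {..<n - 1}" using n by auto
  have inj: "inj_on \<phi> {..<n}" unfolding N using inj1 in1 top v by auto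
  have "r (\<phi> i) (\<phi> (p i))" if i: "0 < i" "i < n" for i
  proof (cases "i = n - 1")
    case True then show ?thesis using top v by simp
  next
    case False
    then have "i < n - 1" "p i < i" using p i by (auto simp: parent_fun_def)
    moreover from this have "\<phi> i \<noteq> \<phi> (p i)" using inj1 by (auto dest!: inj_onD)
    ultimately show ?thesis using in1[of i] in1[of "p i"] A(3) by (auto simp: pairwise_def)
  qed
  moreover have "\<phi> ` {..<n} \<subseteq> insert v A" unfolding N using in1 top by auto
  ultimately show ?thesis unfolding embeds_def using inj by (intro exI[of _ \<phi>]) blast
qed

text \<open>
  When vertex \<open>k\<close> is placed next to the image of its parent, at most \<open>k - 1 < n - 1\<close> neighbours of that
  image are occupied.
\<close>

lemma min_degree_embeds:
  assumes p: "parent_fun p n" and U: "finite U" "U \<noteq> {}" and r: "symp r"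
    and deg: "\<And>x. x \<in> U \<Longrightarrow> n - 1 \<le> card {y\<in>U. y \<noteq> x \<and> r x y}"
  shows "embeds p n r U"
proof -
  have "k \<le> n \<Longrightarrow> embeds p k r U" for k
  proof (induction k)
    case 0 then show ?case by (auto simp: embeds_def)
  next
    case (Suc k)
    then obtain \<phi> where \<phi>: "inj_on \<phi> {..<k}" "\<phi> ` {..<k} \<subseteq> U"
      "\<And>i. 0 < i \<Longrightarrow> i < k \<Longrightarrow> r (\<phi> i) (\<phi> (p i))" by (auto simp: embeds_def)
    have "\<exists>y\<in>U. y \<notin> \<phi> ` {..<k} \<and> (0 < k \<longrightarrow> r (\<phi> (p k)) y)"
    proof (cases "k = 0")
      case True then show ?thesis using U by auto
    next
      case False
      let ?x = "\<phi> (p k)" and ?Y = "{y\<in>U. y \<noteq> \<phi> (p k) \<and> r (\<phi> (p k)) y}"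
      have pk: "p k < k" using p False Suc.prems by (auto simp: parent_fun_def)
      have "card (\<phi> ` {..<k} - {?x}) = k - 1"
        using \<phi>(1) pk by (simp add: card_image)
      moreover have "n - 1 \<le> card ?Y" using deg \<phi> pk by auto
      ultimately have "card (\<phi> ` {..<k} - {?x}) < card ?Y" using Suc.prems False by simp
      then have "\<not> ?Y \<subseteq> \<phi> ` {..<k} - {?x}"
        by (meson card_mono finite_Diff finite_imageI finite_lessThan not_le)
      then show ?thesis by auto
    qed
    then obtain y where y: "y \<in> U" "y \<notin> \<phi> ` {..<k}" "0 < k \<Longrightarrow> r (\<phi> (p k)) y" by blast
    let ?\<psi> = "\<phi>(k := y)"
    have "r (?\<psi> i) (?\<psi> (p i))" if i: "0 < i" "i < Suc k" for i
    proof -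
      have "p i < i" using p i Suc.prems by (auto simp: parent_fun_def)
      then show ?thesis using i \<phi>(3)[of i] y(3) sympD[OF r] by (cases "i = k") auto
    qed
    moreover have "inj_on ?\<psi> {..<Suc k}" using \<phi>(1) y(2) by (auto simp: inj_on_def less_Suc_eq)
    moreover have "?\<psi> ` {..<Suc k} \<subseteq> U" using \<phi>(2) y(1) by (auto simp: less_Suc_eq)
    ultimately show ?case unfolding embeds_def by (intro exI[of _ ?\<psi>]) blast
  qed
  then show ?thesis by simp
qed

section \<open>Few vertices send many red edges to a large red clique\<close>

text \<open>
  A weak form of the Kovari--Sos--Turan argument: among enough sets of density at least \<open>1/q\<close>, some \<open>s\<close> have a
  common part of at least \<open>2 * s\<close> elements. By double counting, at least \<open>n / (2 * q)\<close> points lie in \<open>s\<close> or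
  more of the sets, and by pigeonhole many of these points choose the same \<open>s\<close> sets.
\<close>

lemma common_intersection:
  fixes F :: "'w \<Rightarrow> 'a set"
  assumes A: "finite A" "card A \<le> n" and W: "finite W" "card W = 2 * q * s"
    and F: "\<And>w. w \<in> W \<Longrightarrow> F w \<subseteq> A \<and> n \<le> q * card (F w)"
    and qs: "1 \<le> q" "1 \<le> s" and n: "4 * q * s * 2 ^ (2 * q * s) \<le> n"
  shows "\<exists>S\<subseteq>W. card S = s \<and> 2 * s \<le> card {a\<in>A. \<forall>w\<in>S. a \<in> F w}"
proof -
  define \<tau> where "\<tau> a = {w\<in>W. a \<in> F w}" for a
  \<comment> \<open>\<open>\<tau> a\<close> collects the sets that contain \<open>a\<close>; points in \<open>H\<close> can choose \<open>s\<close> of them.\<close>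
  define H where "H = {a\<in>A. s \<le> card (\<tau> a)}"
  have fA: "finite (F w)" if "w \<in> W" for w using F[OF that] A finite_subset by blast
  have dc: "(\<Sum>w\<in>W. card (F w)) = (\<Sum>a\<in>A. card (\<tau> a))"
  proof -
    have "{a\<in>A. a \<in> F w} = F w" if "w \<in> W" for w using F[OF that] by auto
    then have "(\<Sum>w\<in>W. card (F w)) = (\<Sum>w\<in>W. card {a\<in>A. a \<in> F w})" by simp
    also have "\<dots> = (\<Sum>a\<in>A. card (\<tau> a))"
      using A(1) W(1) by (intro sum_multicount_gen) (auto simp: \<tau>_def)
    finally show ?thesis .
  qed
  have "2 * s * q * n = (\<Sum>w\<in>W. n)" using W by simp
  also have "\<dots> \<le> (\<Sum>w\<in>W. q * card (F w))" using F by (intro sum_mono) auto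
  also have "\<dots> = q * (\<Sum>w\<in>W. card (F w))" by (simp add: sum_distrib_left)
  finally have "2 * s * n \<le> (\<Sum>a\<in>A. card (\<tau> a))" using qs dc by (simp add: mult.assoc mult.left_commute)
  also have "\<dots> = (\<Sum>a\<in>H. card (\<tau> a)) + (\<Sum>a\<in>A - H. card (\<tau> a))"
    using A sum.subset_diff[of H A "\<lambda>a. card (\<tau> a)"] by (auto simp: H_def)
  also have "(\<Sum>a\<in>H. card (\<tau> a)) \<le> (\<Sum>a\<in>H. 2 * q * s)"
    by (intro sum_mono) (use W in \<open>auto simp: \<tau>_def intro: order_trans[OF card_mono]\<close>)
  also have "(\<Sum>a\<in>A - H. card (\<tau> a)) \<le> (\<Sum>a\<in>A - H. s)" by (intro sum_mono) (auto simp: H_def)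
  also have "(\<Sum>a\<in>A - H. s) \<le> n * s"
    using A card_mono[of A "A - H"] by (simp)
  finally have "s * n \<le> card H * (2 * q * s)" by simp
  then have nH: "n \<le> card H * (2 * q)" using qs by (simp add: mult_ac)
  have "\<forall>a\<in>H. \<exists>S. S \<subseteq> \<tau> a \<and> card S = s"
    by (auto simp: H_def intro: obtain_subset_with_card_n)
  then obtain g where g: "\<And>a. a \<in> H \<Longrightarrow> g a \<subseteq> \<tau> a \<and> card (g a) = s" by metis
  have gW: "g ` H \<subseteq> Pow W" using g by (auto simp: \<tau>_def)
  have fH: "finite H" using A by (simp add: H_def)
  have "\<exists>S\<in>g ` H. 2 * s \<le> card {a\<in>H. g a = S}"
  proof (rule ccontr)
    assume no: "\<not> ?thesis"
    have "card H = (\<Sum>S\<in>g ` H. card {a\<in>H. g a = S})"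
      using fH by (simp add: sum.image_gen[of H "\<lambda>_. 1::nat" g, simplified])
    also have "\<dots> \<le> (\<Sum>S\<in>g ` H. 2 * s - 1)" using no by (intro sum_mono) force
    also have "\<dots> \<le> card (Pow W) * (2 * s - 1)"
      using card_mono[OF _ gW] W by simp
    finally have "card H \<le> 2 ^ (2 * q * s) * (2 * s - 1)" using W by (simp add: card_Pow)
    then have "card H * (2 * q) \<le> 2 ^ (2 * q * s) * (2 * s - 1) * (2 * q)" by (rule mult_right_mono) simp
    also have "\<dots> < 2 ^ (2 * q * s) * (2 * s) * (2 * q)" using qs by simp
    finally have "card H * (2 * q) < 2 ^ (2 * q * s) * (2 * s) * (2 * q)" .
    moreover have "2 ^ (2 * q * s) * (2 * s) * (2 * q) = 4 * q * s * 2 ^ (2 * q * s)" by simp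
    ultimately show False using nH n by linarith
  qed
  then obtain S where S: "S \<in> g ` H" "2 * s \<le> card {a\<in>H. g a = S}" by blast
  have "{a\<in>H. g a = S} \<subseteq> {a\<in>A. \<forall>w\<in>S. a \<in> F w}" using g by (auto simp: H_def \<tau>_def)
  then have "2 * s \<le> card {a\<in>A. \<forall>w\<in>S. a \<in> F w}"
    using S(2) A(1) by (elim order_trans, intro card_mono) auto
  then show ?thesis using S(1) g gW by (intro exI[of _ S]) auto
qed

text \<open>
  Otherwise some \<open>C\<close> of these outside vertices have \<open>2 * C\<close> common red neighbours in \<open>A\<close>, and adding them
  to the clique \<open>A\<close> makes room for the tree.
\<close>

lemma few_attached_vertices:
  assumes p: "parent_fun p n" and U: "finite U" and r: "symp r" and ne: "\<not> embeds p n r U"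
    and A: "A \<subseteq> U" "pairwise r A" "n \<le> card A + C"
    and q: "1 \<le> q" and n: "4 * q * C * 2 ^ (2 * q * C) \<le> n" "6 * C \<le> n"
  shows "card {w\<in>U - A. n \<le> q * card {a\<in>A. r w a}} \<le> 2 * q * C"
proof (rule ccontr)
  let ?W = "{w\<in>U - A. n \<le> q * card {a\<in>A. r w a}}"
  assume "\<not> card ?W \<le> 2 * q * C"
  then have "2 * q * C \<le> card ?W" by linarith
  then obtain W where W: "W \<subseteq> ?W" "card W = 2 * q * C" "finite W" by (rule obtain_subset_with_card_n)
  have fA: "finite A" using A U finite_subset by blast
  have "\<not> n \<le> card A" using clique_embeds[OF p fA _ A(2)] embeds_mono[OF _ A(1)] ne by blast
  then have C: "1 \<le> C" and cA: "card A \<le> n" using A by linarith+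
  have "\<exists>S\<subseteq>W. card S = C \<and> 2 * C \<le> card {a\<in>A. \<forall>w\<in>S. a \<in> {a\<in>A. r w a}}"
    using W by (intro common_intersection[OF fA cA W(3,2) _ q C n(1)]) blast
  then obtain S where S: "S \<subseteq> W" "card S = C" "2 * C \<le> card {a\<in>A. \<forall>w\<in>S. a \<in> {a\<in>A. r w a}}" by blast
  have fS: "finite S" using S W finite_subset by blast
  have AS: "A \<inter> S = {}" "S \<subseteq> U" using S W by auto
  then have cl: "A \<union> S - S = A" by blast
  have "embeds p n r (A \<union> S)"
  proof (rule near_clique_embeds[OF p])
    show "finite (A \<union> S)" using fA fS by simp
    show "n \<le> card (A \<union> S)" using A S AS fA fS by (simp add: card_Un_disjoint)
    show "6 * card S \<le> n" using n S by simp
    show "{a\<in>A. \<forall>w\<in>S. a \<in> {a\<in>A. r w a}} \<subseteq> A \<union> S - S" using AS by auto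
    show "2 * card S \<le> card {a\<in>A. \<forall>w\<in>S. a \<in> {a\<in>A. r w a}}" using S by simp
    show "pairwise r (A \<union> S - S)" unfolding cl by (rule A(2))
    show "r x y \<and> r y x" if "x \<in> S" "y \<in> {a\<in>A. \<forall>w\<in>S. a \<in> {a\<in>A. r w a}}" for x y
      using that sympD[OF r] by auto
  qed auto
  then show False using ne embeds_mono[of p n r "A \<union> S" U] A AS by blast
qed

section \<open>Completing partial blue cliques\<close>

text \<open>
  Choose the representatives one after the other: each choice deletes at most \<open>d\<close> vertices from every
  remaining set.
\<close>

lemma blue_transversal:
  assumes "finite J" and r: "symp r" and "\<And>j. j \<in> J \<Longrightarrow> finite (F j)"
    and "\<And>i j x. i \<in> J \<Longrightarrow> j \<in> J \<Longrightarrow> i \<noteq> j \<Longrightarrow> x \<in> F i \<Longrightarrow> card {y\<in>F j. r x y} \<le> d"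
    and "\<And>j. j \<in> J \<Longrightarrow> card J * d < card (F j)"
  shows "\<exists>f. (\<forall>j\<in>J. f j \<in> F j) \<and> (\<forall>i\<in>J. \<forall>j\<in>J. i \<noteq> j \<longrightarrow> \<not> r (f i) (f j))"
  using assms(1,3-)
proof (induction J arbitrary: F)
  case empty then show ?case by simp
next
  case (insert j0 J)
  have "F j0 \<noteq> {}" using insert.prems(3)[of j0] by auto
  then obtain x where x: "x \<in> F j0" by auto
  let ?F = "\<lambda>j. {y\<in>F j. \<not> r x y}"
  have "\<exists>f. (\<forall>j\<in>J. f j \<in> ?F j) \<and> (\<forall>i\<in>J. \<forall>j\<in>J. i \<noteq> j \<longrightarrow> \<not> r (f i) (f j))"
  proof (rule insert.IH)
    show "finite (?F j)" if "j \<in> J" for j using that insert.prems(1) by simp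
    show "card {y\<in>?F j. r z y} \<le> d" if "i \<in> J" "j \<in> J" "i \<noteq> j" "z \<in> ?F i" for i j z
    proof -
      have "card {y\<in>?F j. r z y} \<le> card {y\<in>F j. r z y}"
        using insert.prems(1) that by (intro card_mono) auto
      then show ?thesis using insert.prems(2)[of i j z] that by auto
    qed
    show "card J * d < card (?F j)" if j: "j \<in> J" for j
    proof -
      have "card (F j) = card (?F j) + card {y\<in>F j. r x y}"
        using insert.prems(1) j by (subst card_Un_disjoint[symmetric]) (auto intro: arg_cong[where f = card])
      moreover have "card {y\<in>F j. r x y} \<le> d" using insert.prems(2)[of j0 j x] insert.hyps j x by auto
      moreover have "card J * d + d < card (F j)" using insert.prems(3)[of j] insert.hyps j by simp
      ultimately show ?thesis by linarith
    qed
  qed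
  then obtain f where f: "\<forall>j\<in>J. f j \<in> ?F j" "\<forall>i\<in>J. \<forall>j\<in>J. i \<noteq> j \<longrightarrow> \<not> r (f i) (f j)" by blast
  let ?f = "f(j0 := x)"
  have "\<forall>j\<in>insert j0 J. ?f j \<in> F j" using f(1) x insert.hyps by auto
  moreover have "\<forall>i\<in>insert j0 J. \<forall>j\<in>insert j0 J. i \<noteq> j \<longrightarrow> \<not> r (?f i) (?f j)"
    using f insert.hyps sympD[OF r] by auto
  ultimately show ?case by blast
qed

lemma disjoint_family_on_Suc:
  assumes "disjoint_family_on R {..<k}" "\<And>l. l < k \<Longrightarrow> P \<inter> R l = {}"
  shows "disjoint_family_on (R(k := P)) {..<Suc k}"
  unfolding disjoint_family_on_def
proof (intro ballI impI)
  fix i j assume "i \<in> {..<Suc k}" "j \<in> {..<Suc k}" "i \<noteq> j"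
  then consider "i < k" "j < k" "i \<noteq> j" | "i = k" "j < k" | "i < k" "j = k" by (auto simp: less_Suc_eq)
  then show "(R(k := P)) i \<inter> (R(k := P)) j = {}"
    using assms by cases (auto simp: disjoint_family_on_def)
qed

text \<open>
  A seed \<open>Q k\<close> is a partial clique that lacks one vertex from each \<open>A j\<close> with \<open>j \<in> J k\<close>; the candidates
  for that vertex are \<open>F k j\<close>. The seeds are completed one by one. The vertices of all seeds and of the
  cliques finished before number at most \<open>2 * t * m\<close>, which explains the lower bound on
  \<open>card (F k j)\<close>.
\<close>

lemma seeds_extend:
  fixes Q :: "nat \<Rightarrow> 'v set" and J :: "nat \<Rightarrow> nat set" and F :: "nat \<Rightarrow> nat \<Rightarrow> 'v set"
  assumes r: "symp r" and b: "symp b"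
    and Q: "\<And>k. k < t \<Longrightarrow> finite (Q k) \<and> pairwise b (Q k) \<and> card (Q k) + card (J k) = m"
    and J: "\<And>k. k < t \<Longrightarrow> J k \<subseteq> {..<M}"
    and disQ: "disjoint_family_on Q {..<t}" and disA: "disjoint_family_on A {..<M}"
    and A: "\<And>j. j < M \<Longrightarrow> finite (A j)"
    and F: "\<And>k j. k < t \<Longrightarrow> j \<in> J k \<Longrightarrow> F k j \<subseteq> A j \<and> m * d + 2 * t * m < card (F k j)"
    and FQ: "\<And>k j x y. k < t \<Longrightarrow> j \<in> J k \<Longrightarrow> x \<in> F k j \<Longrightarrow> y \<in> Q k \<Longrightarrow> b x y"
    and cross: "\<And>i j x. i < M \<Longrightarrow> j < M \<Longrightarrow> i \<noteq> j \<Longrightarrow> x \<in> A i \<Longrightarrow> card {y\<in>A j. r x y} \<le> d"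
    and blue: "\<And>i j x y. i < M \<Longrightarrow> j < M \<Longrightarrow> i \<noteq> j \<Longrightarrow> x \<in> A i \<Longrightarrow> y \<in> A j \<Longrightarrow> \<not> r x y \<Longrightarrow> b x y"
  shows "\<exists>R. disjoint_family_on R {..<t} \<and>
    (\<forall>k<t. card (R k) = m \<and> pairwise b (R k) \<and> R k \<subseteq> Q k \<union> (\<Union>j<M. A j))"
proof -
  define Z where "Z = (\<Union>k<t. Q k)"
  have fZ: "finite Z" using Q by (auto simp: Z_def)
  have "card Z \<le> (\<Sum>k<t. card (Q k))" unfolding Z_def by (rule card_UN_le) simp
  also have "\<dots> \<le> (\<Sum>k<t. m)" using Q by (intro sum_mono) (metis le_add1 lessThan_iff)
  finally have cZ: "card Z \<le> t * m" by simp
  have "k \<le> t \<Longrightarrow> \<exists>R. disjoint_family_on R {..<k} \<and>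
    (\<forall>l<k. finite (R l) \<and> card (R l) = m \<and> pairwise b (R l) \<and> R l \<subseteq> Q l \<union> ((\<Union>j<M. A j) - Z))" for k
  proof (induction k)
    case 0 then show ?case by (simp add: disjoint_family_on_def)
  next
    case (Suc k)
    then have kt: "k < t" and "k \<le> t" by auto
    from Suc.IH[OF this(2)] obtain R where R: "disjoint_family_on R {..<k}"
      "\<And>l. l < k \<Longrightarrow> finite (R l) \<and> card (R l) = m \<and> pairwise b (R l) \<and> R l \<subseteq> Q l \<union> ((\<Union>j<M. A j) - Z)"
      by blast
    define Y where "Y = (\<Union>l<k. R l)"
    have fY: "finite Y" using R(2) by (auto simp: Y_def)
    have "card Y \<le> (\<Sum>l<k. card (R l))" unfolding Y_def by (rule card_UN_le) simp
    also have "\<dots> = k * m" using R(2) by simp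
    also have "\<dots> \<le> t * m" using kt by simp
    finally have cY: "card Y \<le> t * m" .
    let ?G = "\<lambda>j. F k j - (Z \<union> Y)"
    have fJ: "finite (J k)" using J[OF kt] finite_subset by blast
    have JM: "j < M" if "j \<in> J k" for j using J[OF kt] that by auto
    have fF: "finite (F k j)" if "j \<in> J k" for j
      using F[OF kt that] A[OF JM[OF that]] finite_subset by blast
    have "\<exists>f. (\<forall>j\<in>J k. f j \<in> ?G j) \<and> (\<forall>i\<in>J k. \<forall>j\<in>J k. i \<noteq> j \<longrightarrow> \<not> r (f i) (f j))"
    proof (rule blue_transversal[OF fJ r])
      show "finite (?G j)" if "j \<in> J k" for j using fF that by simp
      show "card {y\<in>?G j. r x y} \<le> d" if ij: "i \<in> J k" "j \<in> J k" "i \<noteq> j" "x \<in> ?G i" for i j x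
      proof -
        have "card {y\<in>?G j. r x y} \<le> card {y\<in>A j. r x y}"
          using F[OF kt ij(2)] A[OF JM[OF ij(2)]] by (intro card_mono) auto
        also have "\<dots> \<le> d" using cross[of i j x] JM ij F[OF kt ij(1)] by blast
        finally show ?thesis .
      qed
      show "card (J k) * d < card (?G j)" if j: "j \<in> J k" for j
      proof -
        have "card (F k j) - card (Z \<union> Y) \<le> card (?G j)" by (rule diff_card_le_card_Diff) (use fZ fY in simp)
        moreover have "card (Z \<union> Y) \<le> 2 * t * m" using card_Un_le[of Z Y] cZ cY by linarith
        moreover have "card (J k) * d \<le> m * d" using Q[OF kt] by simp
        ultimately show ?thesis using F[OF kt j] by linarith
      qed
    qed
    then obtain f where f: "\<And>j. j \<in> J k \<Longrightarrow> f j \<in> ?G j"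
      "\<And>i j. i \<in> J k \<Longrightarrow> j \<in> J k \<Longrightarrow> i \<noteq> j \<Longrightarrow> \<not> r (f i) (f j)" by blast
    have fA: "f j \<in> A j" if "j \<in> J k" for j using f(1)[OF that] F[OF kt that] by auto
    have finj: "inj_on f (J k)"
    proof (rule inj_onI)
      fix i j assume ij: "i \<in> J k" "j \<in> J k" "f i = f j"
      show "i = j"
      proof (rule ccontr)
        assume "i \<noteq> j"
        then have "A i \<inter> A j = {}" using disA ij JM by (auto simp: disjoint_family_on_def)
        then show False using fA[of i] fA[of j] ij by auto
      qed
    qed
    define P where "P = Q k \<union> f ` J k"
    have QZ: "Q l \<subseteq> Z" if "l < t" for l using that by (auto simp: Z_def)
    have fZ': "f ` J k \<inter> Z = {}" "f ` J k \<inter> Y = {}" using f(1) by auto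
    have "card P = m"
      using Q[OF kt] finj fJ QZ[OF kt] fZ' unfolding P_def
      by (subst card_Un_disjoint) (auto simp: card_image)
    moreover have "finite P" using Q[OF kt] fJ by (simp add: P_def)
    moreover have "pairwise b P" unfolding P_def
    proof (rule pairwiseI)
      fix x y assume xy: "x \<in> Q k \<union> f ` J k" "y \<in> Q k \<union> f ` J k" "x \<noteq> y"
      have 1: "b z w \<and> b w z" if "z \<in> Q k" "w \<in> f ` J k" for z w
        using that FQ[OF kt] f(1) sympD[OF b] by blast
      have 2: "b z w" if zw: "z \<in> f ` J k" "w \<in> f ` J k" "z \<noteq> w" for z w
      proof -
        obtain i j where "i \<in> J k" "j \<in> J k" "i \<noteq> j" "z = f i" "w = f j" using zw by blast
        then show ?thesis using blue[of i j z w] JM fA f(2) by blast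
      qed
      show "b x y" using xy 1 2 Q[OF kt] by (auto simp: pairwise_def)
    qed
    moreover have "P \<subseteq> Q k \<union> ((\<Union>j<M. A j) - Z)" using fA JM fZ' by (auto simp: P_def)
    moreover have PR: "P \<inter> R l = {}" if l: "l < k" for l
    proof -
      have "Q k \<inter> Q l = {}" using disQ l kt by (auto simp: disjoint_family_on_def)
      moreover have "R l \<subseteq> Q l \<union> ((\<Union>j<M. A j) - Z)" using R(2)[OF l] by blast
      moreover have "f ` J k \<inter> R l = {}" using fZ'(2) l by (auto simp: Y_def)
      ultimately show ?thesis using QZ[OF kt] by (auto simp: P_def)
    qed
    moreover have "disjoint_family_on (R(k := P)) {..<Suc k}"
      using disjoint_family_on_Suc[OF R(1) PR] .
    ultimately show ?case
      using R(2) by (intro exI[of _ "R(k := P)"] conjI) (assumption, auto simp: less_Suc_eq)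
  qed
  from this[OF order_refl] obtain R where "disjoint_family_on R {..<t}"
    "\<forall>l<t. finite (R l) \<and> card (R l) = m \<and> pairwise b (R l) \<and> R l \<subseteq> Q l \<union> ((\<Union>j<M. A j) - Z)"
    by blast
  then show ?thesis by (intro exI[of _ R] conjI) (assumption, blast)
qed

section \<open>Stability: disjoint large red cliques\<close>

lemma card_le_div: "0 < q \<Longrightarrow> \<not> n \<le> q * x \<Longrightarrow> x \<le> n div (q::nat)"
  by (simp add: less_eq_div_iff_mult_less_eq mult.commute)

text \<open>
  Induction on the number \<open>k\<close> of cliques. A vertex \<open>x\<close> of red degree at most \<open>n - 2\<close> has at least
  \<open>(n - 1) * k - C\<close> blue neighbours, among which the induction hypothesis finds \<open>k\<close> red cliques \<open>A j\<close>. At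
  least \<open>n - 1 - C\<close> vertices of \<open>U\<close> lie outside these, and all but boundedly many vertices have red
  degree below \<open>n / q\<close> into each \<open>A j\<close> that does not contain them. The unexceptional outside vertices
  form the new red clique: two of them joined by a blue edge would have most of every \<open>A j\<close> as common
  blue neighbours, and extend to a blue clique on \<open>k + 2\<close> vertices.
\<close>

lemma clique_stability:
  "\<exists>C' n0. \<forall>n\<ge>n0. \<forall>p (r :: 'v \<Rightarrow> 'v \<Rightarrow> bool) U. parent_fun p n \<and> symp r \<and> finite U \<and>
     (n - 1) * k \<le> card U + C \<and> \<not> embeds p n r U \<and>
     \<not> (\<exists>K\<subseteq>U. card K = k + 1 \<and> pairwise (\<lambda>x y. \<not> r x y) K) \<longrightarrow>
     (\<exists>A. (\<forall>j<k. A j \<subseteq> U \<and> pairwise r (A j) \<and> n \<le> card (A j) + C') \<and> disjoint_family_on A {..<k})"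
proof (induction k)
  case 0 then show ?case by (auto simp: disjoint_family_on_def)
next
  case (Suc k)
  from Suc.IH obtain C0 n0 where IH: "\<forall>n\<ge>n0. \<forall>p (r :: 'v \<Rightarrow> 'v \<Rightarrow> bool) U. parent_fun p n \<and> symp r \<and> finite U \<and>
     (n - 1) * k \<le> card U + C \<and> \<not> embeds p n r U \<and>
     \<not> (\<exists>K\<subseteq>U. card K = k + 1 \<and> pairwise (\<lambda>x y. \<not> r x y) K) \<longrightarrow>
     (\<exists>A. (\<forall>j<k. A j \<subseteq> U \<and> pairwise r (A j) \<and> n \<le> card (A j) + C0) \<and> disjoint_family_on A {..<k})"
    by (elim exE)
  \<comment> \<open>With this \<open>q\<close>, the \<open>k\<close> deletions of the transversal and the red neighbourhoods of the two new vertices cost at most \<open>n / 2\<close> vertices.\<close>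
  define q where "q = 2 * (k + 2)"
  define E where "E = k * (2 * q * C0)"
  define n1 where "n1 = n0 + 2 * (C0 + E) + C + 4 * q * C0 * 2 ^ (2 * q * C0) + 6 * C0 + 2"
  have step: "\<exists>A. (\<forall>j<Suc k. A j \<subseteq> U \<and> pairwise r (A j) \<and> n \<le> card (A j) + (C0 + 1 + C + E)) \<and>
      disjoint_family_on A {..<Suc k}"
    if n: "n1 \<le> n" and p: "parent_fun p n" and r: "symp r" and U: "finite U"
      and cU: "(n - 1) * Suc k \<le> card U + C" and ne: "\<not> embeds p n r U"
      and noblue: "\<not> (\<exists>K\<subseteq>U. card K = Suc k + 1 \<and> pairwise (\<lambda>x y. \<not> r x y) K)"
    for n p and r :: "'v \<Rightarrow> 'v \<Rightarrow> bool" and U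
  proof -
    have n': "n0 \<le> n" "4 * q * C0 * 2 ^ (2 * q * C0) \<le> n" "6 * C0 \<le> n" "C + 2 \<le> n" "2 * (C0 + E) + 2 \<le> n"
      using n unfolding n1_def by linarith+
    have cU': "(n - 1) * k + (n - 1) \<le> card U + C" using cU by simp
    have "card U \<noteq> 0" using cU' n'(4) by linarith
    then have "U \<noteq> {}" by auto
    then have "\<not> (\<forall>x\<in>U. n - 1 \<le> card {y\<in>U. y \<noteq> x \<and> r x y})"
      using min_degree_embeds[OF p U _ r] ne by auto
    then obtain x where x: "x \<in> U" "\<not> n - 1 \<le> card {y\<in>U. y \<noteq> x \<and> r x y}" by blast
    define U1 where "U1 = {y\<in>U. y \<noteq> x \<and> \<not> r x y}"
    have U1: "finite U1" "U1 \<subseteq> U" using U by (auto simp: U1_def)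
    have "U - {x} = {y\<in>U. y \<noteq> x \<and> r x y} \<union> U1" by (auto simp: U1_def)
    then have "card U = Suc (card ({y\<in>U. y \<noteq> x \<and> r x y} \<union> U1))"
      using card_Suc_Diff1[OF U x(1)] by simp
    also have "\<dots> \<le> Suc (card {y\<in>U. y \<noteq> x \<and> r x y} + card U1)" using card_Un_le by simp
    finally have cU1: "(n - 1) * k \<le> card U1 + C" using cU' x(2) by linarith
    have "\<not> (\<exists>K\<subseteq>U1. card K = k + 1 \<and> pairwise (\<lambda>x y. \<not> r x y) K)"
    proof
      assume "\<exists>K\<subseteq>U1. card K = k + 1 \<and> pairwise (\<lambda>x y. \<not> r x y) K"
      then obtain K where K: "K \<subseteq> U1" "card K = k + 1" "pairwise (\<lambda>x y. \<not> r x y) K" by blast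
      have "finite K" using K U1 finite_subset by blast
      moreover have "x \<notin> K" using K by (auto simp: U1_def)
      moreover have "pairwise (\<lambda>x y. \<not> r x y) (insert x K)"
        unfolding pairwise_insert using K sympD[OF r] by (auto simp: U1_def)
      ultimately show False using noblue K U1 x(1) by (auto dest!: spec[of _ "insert x K"])
    qed
    moreover have "\<not> embeds p n r U1" using ne embeds_mono[OF _ U1(2)] by blast
    ultimately have "\<exists>A. (\<forall>j<k. A j \<subseteq> U1 \<and> pairwise r (A j) \<and> n \<le> card (A j) + C0) \<and> disjoint_family_on A {..<k}"
      using IH[rule_format, OF n'(1), of p r U1] p r U1(1) cU1 by blast
    then obtain A where A: "\<And>j. j < k \<Longrightarrow> A j \<subseteq> U1 \<and> pairwise r (A j) \<and> n \<le> card (A j) + C0"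
      "disjoint_family_on A {..<k}" by blast
    have AU: "A j \<subseteq> U" and fA: "finite (A j)" if "j < k" for j
      using A(1)[OF that] U1 finite_subset by blast+
    have cA: "card (A j) \<le> n - 1" if "j < k" for j
      using clique_embeds[OF p fA[OF that], of r] A(1)[OF that] embeds_mono[OF _ AU[OF that], of p n r] ne by force
    define Bd where "Bd j = {w\<in>U - A j. n \<le> q * card {a\<in>A j. r w a}}" for j
    have cBd: "card (Bd j) \<le> 2 * q * C0" if "j < k" for j
      unfolding Bd_def using A(1)[OF that] n'
      by (intro few_attached_vertices[OF p U r ne AU[OF that]]) (auto simp: q_def)
    define X where "X = (\<Union>j<k. Bd j)"
    have fX: "finite X" using U by (auto simp: X_def Bd_def)
    have "card X \<le> (\<Sum>j<k. card (Bd j))" unfolding X_def by (rule card_UN_le) simp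
    also have "\<dots> \<le> (\<Sum>j<k. 2 * q * C0)" using cBd by (intro sum_mono) auto
    finally have cX: "card X \<le> E" by (simp add: E_def)
    define d where "d = n div q"
    have qd: "2 * ((k + 2) * d) \<le> n" unfolding d_def q_def
      using times_div_less_eq_dividend[of "2 * (k + 2)" n] by (simp add: mult.assoc)
    have q0: "0 < q" by (simp add: q_def)
    have deg: "card {a\<in>A j. r w a} \<le> d" if "j < k" "w \<in> U - A j" "w \<notin> X" for j w
      using that card_le_div[OF q0, of n "card {a\<in>A j. r w a}"] by (auto simp: d_def X_def Bd_def)
    define W where "W = U - (\<Union>j<k. A j) - X"
    have "U \<subseteq> (\<Union>j<k. A j) \<union> (X \<union> W)" by (auto simp: W_def)
    then have "card U \<le> card ((\<Union>j<k. A j) \<union> (X \<union> W))"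
      using U fX fA by (intro card_mono) (auto simp: W_def)
    also have "\<dots> \<le> card (\<Union>j<k. A j) + (card X + card W)"
      using card_Un_le[of "\<Union>j<k. A j" "X \<union> W"] card_Un_le[of X W] by linarith
    also have "card (\<Union>j<k. A j) \<le> (\<Sum>j<k. card (A j))" by (rule card_UN_le) simp
    also have "\<dots> \<le> (\<Sum>j<k. n - 1)" using cA by (intro sum_mono) auto
    finally have "card U \<le> (n - 1) * k + (card X + card W)" by (simp add: mult.commute)
    then have cW: "n \<le> card W + (C0 + 1 + C + E)" using cU' cX by linarith
    have clqW: "pairwise r W"
    proof (rule pairwiseI, rule ccontr)
      fix w w' assume w: "w \<in> W" "w' \<in> W" "w \<noteq> w'" "\<not> r w w'"
      let ?F = "\<lambda>j. {a\<in>A j - X. \<not> r w a \<and> \<not> r w' a}"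
      have WA: "z \<in> U - A j" "z \<notin> X" if "z \<in> W" "j < k" for z j using that by (auto simp: W_def)
      have "\<exists>f. (\<forall>j\<in>{..<k}. f j \<in> ?F j) \<and> (\<forall>i\<in>{..<k}. \<forall>j\<in>{..<k}. i \<noteq> j \<longrightarrow> \<not> r (f i) (f j))"
      proof (rule blue_transversal[OF finite_lessThan r])
        show "finite (?F j)" if "j \<in> {..<k}" for j using fA that by simp
        show "card {y\<in>?F j. r x y} \<le> d" if ij: "i \<in> {..<k}" "j \<in> {..<k}" "i \<noteq> j" "x \<in> ?F i" for i j x
        proof -
          have "A i \<inter> A j = {}" using A(2) ij by (auto simp: disjoint_family_on_def)
          then have "x \<in> U - A j" "x \<notin> X" using AU ij by auto
          then have "card {y\<in>A j. r x y} \<le> d" using deg ij by auto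
          moreover have "card {y\<in>?F j. r x y} \<le> card {y\<in>A j. r x y}"
            using fA ij by (intro card_mono) auto
          ultimately show ?thesis by linarith
        qed
        show "card {..<k} * d < card (?F j)" if j: "j \<in> {..<k}" for j
        proof -
          have jk: "j < k" using j by simp
          have "A j \<subseteq> ?F j \<union> (X \<union> ({a\<in>A j. r w a} \<union> {a\<in>A j. r w' a}))" by auto
          then have "card (A j) \<le> card (?F j \<union> (X \<union> ({a\<in>A j. r w a} \<union> {a\<in>A j. r w' a})))"
            using fA[OF jk] fX by (intro card_mono) auto
          also have "\<dots> \<le> card (?F j) + (card X + (card {a\<in>A j. r w a} + card {a\<in>A j. r w' a}))"
            by (meson add_left_mono card_Un_le order_trans)
          finally have "card (A j) \<le> card (?F j) + (E + (d + d))"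
            using cX deg[OF jk WA[OF w(1) jk]] deg[OF jk WA[OF w(2) jk]] by linarith
          moreover have "n \<le> card (A j) + C0" using A(1)[OF jk] by simp
          moreover have "(k + 2) * d = k * d + (d + d)" by simp
          ultimately show ?thesis using qd n'(5) by simp
        qed
      qed
      then obtain f where f: "\<And>j. j < k \<Longrightarrow> f j \<in> ?F j"
        "\<And>i j. i < k \<Longrightarrow> j < k \<Longrightarrow> i \<noteq> j \<Longrightarrow> \<not> r (f i) (f j)" by auto
      have finj: "inj_on f {..<k}"
      proof (rule inj_onI, rule ccontr)
        fix i j assume ij: "i \<in> {..<k}" "j \<in> {..<k}" "f i = f j" "i \<noteq> j"
        then have "A i \<inter> A j = {}" using A(2) by (auto simp: disjoint_family_on_def)
        then show False using f(1)[of i] f(1)[of j] ij by auto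
      qed
      have nW: "w \<notin> f ` {..<k}" "w' \<notin> f ` {..<k}" using f(1) w(1,2) by (auto simp: W_def)
      let ?K = "insert w (insert w' (f ` {..<k}))"
      have "card ?K = Suc k + 1" using finj nW w(3) by (simp add: card_image)
      moreover have "?K \<subseteq> U" using f(1) AU w(1,2) by (auto simp: W_def)
      moreover have "pairwise (\<lambda>x y. \<not> r x y) (f ` {..<k})"
        using f(2) by (auto simp: pairwise_def)
      then have "pairwise (\<lambda>x y. \<not> r x y) ?K"
        unfolding pairwise_insert using f(1) w(4) sympD[OF r] by auto
      ultimately show False using noblue by blast
    qed
    let ?A = "A(k := W)"
    have "\<forall>j<Suc k. ?A j \<subseteq> U \<and> pairwise r (?A j) \<and> n \<le> card (?A j) + (C0 + 1 + C + E)"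
    proof (intro allI impI)
      fix j assume "j < Suc k"
      then consider "j < k" | "j = k" by linarith
      then show "?A j \<subseteq> U \<and> pairwise r (?A j) \<and> n \<le> card (?A j) + (C0 + 1 + C + E)"
      proof cases
        case 1 then show ?thesis using A(1)[OF 1] AU[OF 1] by simp
      next
        case 2 then show ?thesis using clqW cW by (simp add: W_def) blast
      qed
    qed
    moreover have "disjoint_family_on ?A {..<Suc k}"
      using A(2) by (rule disjoint_family_on_Suc) (auto simp: W_def)
    ultimately show ?thesis by blast
  qed
  show ?case
    by (intro exI[of _ "C0 + 1 + C + E"] exI[of _ n1] allI impI, elim conjE) (rule step)
qed

section \<open>From approximate to exact structure\<close>

definition disjoint_cliques :: "('v \<Rightarrow> 'v \<Rightarrow> bool) \<Rightarrow> nat \<Rightarrow> nat \<Rightarrow> 'v set \<Rightarrow> bool" where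
  "disjoint_cliques b m t U \<longleftrightarrow> (\<exists>R. disjoint_family_on R {..<t} \<and>
     (\<forall>k<t. R k \<subseteq> U \<and> card (R k) = m \<and> pairwise b (R k)))"

lemma disjoint_cliques_mono: "disjoint_cliques b m t U \<Longrightarrow> U \<subseteq> U' \<Longrightarrow> disjoint_cliques b m t U'"
  unfolding disjoint_cliques_def by (meson order_trans)

text \<open>
  Remove pairwise disjoint cliques until either \<open>t\<close> of them are found or none is left.
\<close>

lemma remove_disjoint_cliques:
  assumes U: "finite U"
  shows "disjoint_cliques b m t U \<or>
    (\<exists>U'\<subseteq>U. card U \<le> card U' + t * m \<and> \<not> (\<exists>K\<subseteq>U'. card K = m \<and> pairwise b K))"
proof (induction t)
  case 0 then show ?case by (simp add: disjoint_cliques_def disjoint_family_on_def)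
next
  case (Suc t)
  show ?case
  proof (cases "disjoint_cliques b m t U")
    case False
    with Suc obtain U' where "U' \<subseteq> U" "card U \<le> card U' + t * m" "\<not> (\<exists>K\<subseteq>U'. card K = m \<and> pairwise b K)"
      by blast
    then show ?thesis by (intro disjI2 exI[of _ U']) auto
  next
    case True
    then obtain R where R: "disjoint_family_on R {..<t}"
      "\<And>k. k < t \<Longrightarrow> R k \<subseteq> U \<and> card (R k) = m \<and> pairwise b (R k)"
      unfolding disjoint_cliques_def by blast
    let ?U = "U - (\<Union>k<t. R k)"
    have "card (\<Union>k<t. R k) \<le> (\<Sum>k<t. card (R k))" by (rule card_UN_le) simp
    also have "\<dots> = t * m" using R(2) by simp
    finally have "card U \<le> card ?U + t * m"
      using diff_card_le_card_Diff[of "\<Union>k<t. R k" U] R(2) U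
      by (meson diff_le_mono2 finite_UN_I finite_lessThan finite_subset le_diff_conv lessThan_iff order_trans)
    moreover have "disjoint_cliques b m (Suc t) U" if K: "K \<subseteq> ?U" "card K = m" "pairwise b K" for K
    proof -
      have "disjoint_family_on (R(t := K)) {..<Suc t}"
        using R(1) by (rule disjoint_family_on_Suc) (use K in auto)
      then show ?thesis unfolding disjoint_cliques_def
        using R(2) K by (intro exI[of _ "R(t := K)"] conjI) (assumption, auto simp: less_Suc_eq)
    qed
    moreover have "t * m \<le> Suc t * m" by simp
    ultimately show ?thesis
      by (meson Diff_subset add_left_mono order_trans)
  qed
qed

lemma card_le_add_cover: "finite X \<Longrightarrow> finite Y \<Longrightarrow> Z \<subseteq> X \<union> Y \<Longrightarrow> card Z \<le> card X + card Y"
  by (rule order_trans[OF card_mono card_Un_le]) auto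

text \<open>
  The constants used for cliques \<open>A j\<close> of size at least \<open>n - C\<close>. In this order they bound: the number of
  vertices outside the cliques; the density \<open>1/D\<close> below which a blue degree counts as small, chosen so that
  \<open>max_leftover + 1\<close> such exceptions together cover at most \<open>n/16\<close> of a clique; the much smaller density
  \<open>1/q\<close> below which a red degree between cliques counts as small; the number of vertices violating this;
  and, from below, the order of the tree.
\<close>

definition max_leftover :: "nat \<Rightarrow> nat \<Rightarrow> nat \<Rightarrow> nat" where
  "max_leftover M t C = M * C + t"
definition blue_factor :: "nat \<Rightarrow> nat \<Rightarrow> nat \<Rightarrow> nat" where
  "blue_factor M t C = 16 * (max_leftover M t C + 1)"
definition red_factor :: "nat \<Rightarrow> nat \<Rightarrow> nat \<Rightarrow> nat" where
  "red_factor M t C = 2 * blue_factor M t C * (M + 1)"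
definition max_exceptional :: "nat \<Rightarrow> nat \<Rightarrow> nat \<Rightarrow> nat" where
  "max_exceptional M t C = M * (2 * red_factor M t C * C)"
definition order_bound :: "nat \<Rightarrow> nat \<Rightarrow> nat \<Rightarrow> nat" where
  "order_bound M t C = 4 * red_factor M t C * C * 2 ^ (2 * red_factor M t C * C) + 6 * C +
     32 * (max_leftover M t C + 1) +
     2 * blue_factor M t C * (max_exceptional M t C + 2 * t * (M + 1) + C + 4)"

text \<open>
  The situation reached by \<open>clique_stability\<close>: two colours \<open>r\<close> (red) and \<open>b\<close> (blue) on
  \<open>U\<close>, no red tree, and \<open>M\<close> disjoint red cliques that miss only boundedly many vertices.
\<close>

locale clique_system =
  fixes p :: "nat \<Rightarrow> nat" and n M t C :: nat and r b :: "'v \<Rightarrow> 'v \<Rightarrow> bool" and U :: "'v set"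
    and A :: "nat \<Rightarrow> 'v set"
  assumes p: "parent_fun p n" and r: "symp r" and b: "symp b" and finU: "finite U"
    and blue: "\<And>x y. x \<in> U \<Longrightarrow> y \<in> U \<Longrightarrow> x \<noteq> y \<Longrightarrow> \<not> r x y \<Longrightarrow> b x y"
    and no_tree: "\<not> embeds p n r U"
    and card_U: "card U = (n - 1) * M + (t - 1)"
    and A: "\<And>j. j < M \<Longrightarrow> A j \<subseteq> U \<and> pairwise r (A j) \<and> n \<le> card (A j) + C"
    and disA: "disjoint_family_on A {..<M}"
    and t: "1 \<le> t" and M: "1 \<le> M"
    and n: "order_bound M t C \<le> n"
begin

abbreviation "c \<equiv> max_leftover M t C"
abbreviation "D \<equiv> blue_factor M t C"
abbreviation "q \<equiv> red_factor M t C"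
abbreviation "E \<equiv> max_exceptional M t C"
abbreviation "d \<equiv> n div q"

definition leftover where "leftover = U - (\<Union>j<M. A j)"
text \<open>
  A leftover vertex that has few blue neighbours in several cliques is assigned to only one of them.
  The vertices that remain \<open>bad\<close> have many blue neighbours in every clique.
\<close>

definition class_of where "class_of x = (SOME j. j < M \<and> D * card {a\<in>A j. \<not> r x a} < n)"
definition assigned where "assigned j = {x\<in>leftover. D * card {a\<in>A j. \<not> r x a} < n \<and> class_of x = j}"
definition part where "part j = A j \<union> assigned j"
definition bad where "bad = U - (\<Union>j<M. part j)"
text \<open>
  Vertices with many red neighbours in a foreign clique. Deleting them from the cliques leaves cores that
  are joined to each other almost completely in blue.
\<close>

definition exceptional where "exceptional j = {w\<in>U - A j. n \<le> q * card {a\<in>A j. r w a}}"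
definition core where "core j = A j - (\<Union>i<M. exceptional i)"

lemma D16: "16 \<le> D" by (simp add: blue_factor_def)

lemma n_bounds:
  "4 * q * C * 2 ^ (2 * q * C) \<le> n" "6 * C \<le> n" "32 * (c + 1) \<le> n"
  "2 * D * (E + 2 * t * (M + 1) + C + 4) \<le> n" "32 * (E + 2 * t * (M + 1) + C + 4) \<le> n" "2 \<le> n"
proof -
  show "4 * q * C * 2 ^ (2 * q * C) \<le> n" "6 * C \<le> n" "32 * (c + 1) \<le> n"
    and *: "2 * D * (E + 2 * t * (M + 1) + C + 4) \<le> n"
    using n unfolding order_bound_def by linarith+
  have "32 * (E + 2 * t * (M + 1) + C + 4) \<le> 2 * D * (E + 2 * t * (M + 1) + C + 4)"
    using D16 by (intro mult_right_mono) auto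
  with * show "32 * (E + 2 * t * (M + 1) + C + 4) \<le> n" by (rule order_trans[rotated])
  then show "2 \<le> n" by simp
qed

lemma d_bounds: "2 * D * ((M + 1) * d) \<le> n" "32 * ((M + 1) * d) \<le> n"
proof -
  have "2 * D * ((M + 1) * d) = q * d" by (simp only: red_factor_def mult.assoc)
  also have "\<dots> \<le> n" by simp
  finally show *: "2 * D * ((M + 1) * d) \<le> n" .
  have "32 * ((M + 1) * d) \<le> 2 * D * ((M + 1) * d)" using D16 by (intro mult_right_mono) auto
  with * show "32 * ((M + 1) * d) \<le> n" by (rule order_trans[rotated])
qed

lemma finite_A: "j < M \<Longrightarrow> finite (A j)" using A finU finite_subset by blast

lemma finite_leftover: "finite leftover" using finU by (simp add: leftover_def)

lemma card_leftover: "card leftover \<le> c"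
proof -
  have "card U = card (\<Union>j<M. A j) + card leftover"
    using A finU unfolding leftover_def by (subst card_Un_disjoint[symmetric]) (auto intro: finite_subset arg_cong[where f = card])
  moreover have "card (\<Union>j<M. A j) = (\<Sum>j<M. card (A j))"
    using disA finite_A by (intro card_UN_disjoint) (auto simp: disjoint_family_on_def)
  moreover have "(\<Sum>j<M. n) \<le> (\<Sum>j<M. card (A j) + C)" using A by (intro sum_mono) auto
  then have "M * n \<le> (\<Sum>j<M. card (A j)) + M * C" by (simp add: sum.distrib)
  moreover have "(n - 1) * M \<le> M * n" by simp
  ultimately show ?thesis using card_U unfolding max_leftover_def by linarith
qed

lemma assigned_subset: "assigned j \<subseteq> leftover" by (auto simp: assigned_def)

lemma finite_assigned: "finite (assigned j)" using assigned_subset finite_leftover finite_subset by blast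

lemma card_assigned: "card (assigned j) \<le> c" using card_mono[OF finite_leftover assigned_subset] card_leftover by (rule order_trans)

lemma A_assigned: "j < M \<Longrightarrow> A j \<inter> assigned i = {}" by (auto simp: assigned_def leftover_def)

lemma part_subset: "j < M \<Longrightarrow> part j \<subseteq> U" using A by (auto simp: part_def assigned_def leftover_def)

lemma finite_part: "j < M \<Longrightarrow> finite (part j)" using part_subset finU finite_subset by blast

lemma part_disjoint: assumes "i < M" "j < M" "i \<noteq> j" shows "part i \<inter> part j = {}"
proof -
  have "A i \<inter> A j = {}" using disA assms by (auto simp: disjoint_family_on_def)
  moreover have "assigned i \<inter> assigned j = {}" using assms by (auto simp: assigned_def)
  ultimately show ?thesis using A_assigned[OF assms(1), of j] A_assigned[OF assms(2), of i] unfolding part_def by blast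
qed

lemma attached_embeds:
  assumes "j < M" "finite S'" "A j \<inter> S' = {}" "card S' \<le> c + 1" "n \<le> card (A j \<union> S')"
    "2 * card S' \<le> card {a\<in>A j. \<forall>x\<in>S'. r x a}"
  shows "embeds p n r (A j \<union> S')"
proof (rule near_clique_embeds[OF p])
  have *: "A j \<union> S' - S' = A j" using assms by auto
  show "pairwise r (A j \<union> S' - S')" unfolding * using A assms by auto
  show "{a\<in>A j. \<forall>x\<in>S'. r x a} \<subseteq> A j \<union> S' - S'" unfolding * by auto
  show "r x y \<and> r y x" if "x \<in> S'" "y \<in> {a\<in>A j. \<forall>x\<in>S'. r x a}" for x y
    using that sympD[OF r] by auto
  show "6 * card S' \<le> n" using assms(4) n_bounds(3) by simp
qed (use assms finite_A in auto)

lemma card_blue_assigned: "16 * card {a\<in>A j. \<exists>x\<in>assigned j. \<not> r x a} \<le> n" if j: "j < M"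
proof -
  have "{a\<in>A j. \<exists>x\<in>assigned j. \<not> r x a} = (\<Union>x\<in>assigned j. {a\<in>A j. \<not> r x a})" by auto
  then have "card {a\<in>A j. \<exists>x\<in>assigned j. \<not> r x a} \<le> (\<Sum>x\<in>assigned j. card {a\<in>A j. \<not> r x a})"
    using card_UN_le[OF finite_assigned] by simp
  then have "D * card {a\<in>A j. \<exists>x\<in>assigned j. \<not> r x a} \<le> D * (\<Sum>x\<in>assigned j. card {a\<in>A j. \<not> r x a})" by simp
  also have "\<dots> = (\<Sum>x\<in>assigned j. D * card {a\<in>A j. \<not> r x a})" by (rule sum_distrib_left)
  also have "\<dots> \<le> (\<Sum>x\<in>assigned j. n)" by (intro sum_mono) (auto simp: assigned_def)
  also have "\<dots> = card (assigned j) * n" by simp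
  also have "\<dots> \<le> (c + 1) * n" using card_assigned[of j] by (intro mult_right_mono) simp_all
  finally have "(c + 1) * (16 * card {a\<in>A j. \<exists>x\<in>assigned j. \<not> r x a}) \<le> (c + 1) * n"
    by (simp only: blue_factor_def mult.assoc mult.left_commute)
  then show ?thesis by (simp only: mult_le_cancel1)
qed

text \<open>
  The assigned vertices miss few vertices of their clique, so they have plenty of common red neighbours
  there, and a part with \<open>n\<close> vertices would contain the tree.
\<close>

lemma card_part_le: "card (part j) \<le> n - 1" if j: "j < M"
proof (rule ccontr)
  assume "\<not> card (part j) \<le> n - 1"
  then have big: "n \<le> card (A j \<union> assigned j)" by (simp add: part_def)
  have "A j \<subseteq> {a\<in>A j. \<forall>x\<in>assigned j. r x a} \<union> {a\<in>A j. \<exists>x\<in>assigned j. \<not> r x a}" by auto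
  then have "card (A j) \<le> card ({a\<in>A j. \<forall>x\<in>assigned j. r x a} \<union> {a\<in>A j. \<exists>x\<in>assigned j. \<not> r x a})"
    using finite_A[OF j] by (intro card_mono) auto
  also have "\<dots> \<le> card {a\<in>A j. \<forall>x\<in>assigned j. r x a} + card {a\<in>A j. \<exists>x\<in>assigned j. \<not> r x a}" by (rule card_Un_le)
  finally have "2 * card (assigned j) \<le> card {a\<in>A j. \<forall>x\<in>assigned j. r x a}"
    using card_blue_assigned[OF j] A[OF j] n_bounds(2,3) card_assigned[of j] by simp
  then have "embeds p n r (A j \<union> assigned j)"
    using j finite_assigned A_assigned card_assigned[of j] big by (intro attached_embeds) auto
  then show False using no_tree embeds_mono[of p n r "part j" U] part_subset[OF j] by (simp add: part_def)
qed

text \<open>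
  A part of size \<open>n - 1\<close> leaves no room: one more vertex with a positive fraction of red neighbours in its
  clique would complete the tree.
\<close>

lemma outside_red_degree:
  assumes j: "j < M" and cV: "card (part j) = n - 1" and w: "w \<in> U" "w \<notin> part j"
  shows "8 * card {a\<in>A j. r w a} < n"
proof (rule ccontr)
  assume "\<not> 8 * card {a\<in>A j. r w a} < n"
  then have big: "n \<le> 8 * card {a\<in>A j. r w a}" by simp
  let ?assigned = "insert w (assigned j)"
  have "{a\<in>A j. r w a} \<subseteq> {a\<in>A j. \<forall>x\<in>?assigned. r x a} \<union> {a\<in>A j. \<exists>x\<in>assigned j. \<not> r x a}" by auto
  then have "card {a\<in>A j. r w a} \<le> card ({a\<in>A j. \<forall>x\<in>?assigned. r x a} \<union> {a\<in>A j. \<exists>x\<in>assigned j. \<not> r x a})"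
    using finite_A[OF j] by (intro card_mono) auto
  also have "\<dots> \<le> card {a\<in>A j. \<forall>x\<in>?assigned. r x a} + card {a\<in>A j. \<exists>x\<in>assigned j. \<not> r x a}" by (rule card_Un_le)
  finally have 1: "2 * (c + 1) \<le> card {a\<in>A j. \<forall>x\<in>?assigned. r x a}"
    using card_blue_assigned[OF j] n_bounds(3) big by linarith
  have 2: "card ?assigned \<le> c + 1" using card_assigned[of j] finite_assigned by (simp add: card_insert_if)
  have 3: "A j \<union> ?assigned = insert w (part j)" by (auto simp: part_def)
  have "embeds p n r (A j \<union> ?assigned)"
  proof (rule attached_embeds[OF j])
    show "n \<le> card (A j \<union> ?assigned)" unfolding 3 using cV w finite_part[OF j] by simp
    show "2 * card ?assigned \<le> card {a\<in>A j. \<forall>x\<in>?assigned. r x a}"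
      using 1 2 by (meson mult_le_mono2 order_trans)
    show "A j \<inter> ?assigned = {}" using A_assigned[OF j] w by (auto simp: part_def)
  qed (use 2 finite_assigned in auto)
  then show False unfolding 3 using no_tree embeds_mono[of p n r "insert w (part j)" U] part_subset[OF j] w by auto
qed

lemma card_exceptional: "card (\<Union>j<M. exceptional j) \<le> E"
proof -
  have "card (\<Union>j<M. exceptional j) \<le> (\<Sum>j<M. card (exceptional j))" by (rule card_UN_le) simp
  also have "\<dots> \<le> (\<Sum>j<M. 2 * q * C)"
  proof (rule sum_mono)
    fix j assume "j \<in> {..<M}"
    then have j: "j < M" by simp
    have "1 \<le> q" using D16 by (simp add: red_factor_def)
    then show "card (exceptional j) \<le> 2 * q * C" unfolding exceptional_def
      using A[OF j] n_bounds by (intro few_attached_vertices[OF p finU r no_tree]) auto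
  qed
  finally show ?thesis by (simp add: max_exceptional_def)
qed

lemma finite_exceptional: "finite (\<Union>j<M. exceptional j)" using finU by (auto simp: exceptional_def)

lemma core_subset: "core j \<subseteq> A j" by (auto simp: core_def)

lemma cross: "card {y\<in>core j. r x y} \<le> d" if "i < M" "j < M" "i \<noteq> j" "x \<in> core i"
proof -
  have "x \<in> U - A j" using A[of i] disA core_subset[of i] that by (auto simp: disjoint_family_on_def)
  then have "\<not> n \<le> q * card {a\<in>A j. r x a}" using that by (auto simp: core_def exceptional_def)
  then have "card {a\<in>A j. r x a} \<le> d" using D16 by (intro card_le_div) (auto simp: red_factor_def)
  moreover have "card {y\<in>core j. r x y} \<le> card {a\<in>A j. r x a}"
    using finite_A[OF that(2)] core_subset by (intro card_mono) auto
  ultimately show ?thesis by linarith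
qed

lemma seeds_disjoint_cliques:
  assumes Q: "\<And>k. k < t \<Longrightarrow> finite (Q k) \<and> pairwise b (Q k) \<and> card (Q k) + card (J k) = M + 1 \<and> Q k \<subseteq> insert v U"
    and J: "\<And>k. k < t \<Longrightarrow> J k \<subseteq> {..<M}"
    and disQ: "disjoint_family_on Q {..<t}"
    and F: "\<And>k j. k < t \<Longrightarrow> j \<in> J k \<Longrightarrow> F k j \<subseteq> core j \<and> (M + 1) * d + 2 * t * (M + 1) < card (F k j)"
    and FQ: "\<And>k j x y. k < t \<Longrightarrow> j \<in> J k \<Longrightarrow> x \<in> F k j \<Longrightarrow> y \<in> Q k \<Longrightarrow> b x y"
  shows "disjoint_cliques b (M + 1) t (insert v U)"
proof -
  have "disjoint_family_on core {..<M}" using disA by (rule disjoint_family_on_bisimulation) (use core_subset in blast)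
  moreover have "finite (core j)" if "j < M" for j using finite_A[OF that] core_subset finite_subset by blast
  moreover have "b x y" if "i < M" "j < M" "i \<noteq> j" "x \<in> core i" "y \<in> core j" "\<not> r x y" for i j x y
  proof -
    have "x \<in> A i" "y \<in> A j" "A i \<inter> A j = {}" using that core_subset disA by (auto simp: disjoint_family_on_def)
    then show ?thesis using blue[of x y] A that by blast
  qed
  ultimately obtain R where R: "disjoint_family_on R {..<t}"
    "\<forall>k<t. card (R k) = M + 1 \<and> pairwise b (R k) \<and> R k \<subseteq> Q k \<union> (\<Union>j<M. core j)"
    using seeds_extend[OF r b, of t Q J "M + 1" M core F d] Q J disQ F FQ cross by blast
  have "R k \<subseteq> insert v U" if "k < t" for k using R(2) Q that A core_subset by blast
  then show ?thesis using R unfolding disjoint_cliques_def by blast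
qed

text \<open>
  The choice of \<open>q\<close> as \<open>2 * D * (M + 1)\<close> makes the blue degree \<open>n / D\<close> of a bad vertex twice as large as the
  loss \<open>(M + 1) * n / q\<close> in the greedy completion.
\<close>

lemma bad_seed:
  assumes x: "x \<in> bad" and j: "j < M"
  shows "(M + 1) * d + 2 * t * (M + 1) < card {a\<in>core j. \<not> r x a}"
    and "\<And>a. a \<in> core j \<Longrightarrow> \<not> r x a \<Longrightarrow> b a x"
proof -
  have xX: "x \<in> leftover" using x by (auto simp: bad_def leftover_def part_def)
  have "n \<le> D * card {a\<in>A j. \<not> r x a}"
  proof (rule ccontr)
    assume "\<not> n \<le> D * card {a\<in>A j. \<not> r x a}"
    then have "j < M \<and> D * card {a\<in>A j. \<not> r x a} < n" using j by simp
    then have "class_of x < M \<and> D * card {a\<in>A (class_of x). \<not> r x a} < n"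
      unfolding class_of_def by (rule someI)
    then have "class_of x < M" "x \<in> part (class_of x)" using xX by (simp_all add: part_def assigned_def)
    then have "x \<in> (\<Union>j<M. part j)" by blast
    then show False using x unfolding bad_def by blast
  qed
  moreover have "card {a\<in>A j. \<not> r x a} \<le> card {a\<in>core j. \<not> r x a} + card (\<Union>i<M. exceptional i)"
    using finite_subset[OF core_subset finite_A[OF j]]
    by (intro card_le_add_cover[OF _ finite_exceptional]) (simp, auto simp: core_def)
  then have "card {a\<in>A j. \<not> r x a} \<le> card {a\<in>core j. \<not> r x a} + E" using card_exceptional by linarith
  then have "D * card {a\<in>A j. \<not> r x a} \<le> D * (card {a\<in>core j. \<not> r x a} + E)" by (rule mult_left_mono) simp
  ultimately have "2 * n \<le> 2 * D * (card {a\<in>core j. \<not> r x a} + E)" by linarith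
  moreover have "2 * D * ((M + 1) * d + 2 * t * (M + 1) + E) < 2 * n"
  proof -
    have "2 * D * (2 * t * (M + 1) + E) < 2 * D * (E + 2 * t * (M + 1) + C + 4)"
      using D16 by (intro mult_strict_left_mono) auto
    then show ?thesis using n_bounds(4) d_bounds(1) by (simp only: distrib_left)
  qed
  ultimately have "2 * D * ((M + 1) * d + 2 * t * (M + 1) + E) < 2 * D * (card {a\<in>core j. \<not> r x a} + E)"
    by linarith
  then show "(M + 1) * d + 2 * t * (M + 1) < card {a\<in>core j. \<not> r x a}"
    by (simp only: mult_less_cancel1) simp
  show "b a x" if a: "a \<in> core j" "\<not> r x a" for a
  proof -
    have "a \<in> A j" "x \<notin> A j" "x \<in> U" "A j \<subseteq> U" using a core_subset A[OF j] xX j by (auto simp: leftover_def)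
    then have "b x a" using blue[of x a] a by blast
    then show ?thesis using sympD[OF b] by blast
  qed
qed

lemma card_bad_less: "card bad < t" if "\<not> disjoint_cliques b (M + 1) t U"
proof (rule ccontr)
  assume "\<not> card bad < t"
  then have "card {..<t} \<le> card bad" by simp
  then obtain x where x: "inj_on x {..<t}" "x ` {..<t} \<subseteq> bad"
    using inj_into[of "{..<t}" bad] finU by (auto simp: bad_def)
  have xB: "x k \<in> bad" if "k < t" for k using x that by auto
  then have BU: "x k \<in> U" if "k < t" for k using that by (auto simp: bad_def)
  have "disjoint_cliques b (M + 1) t (insert (x 0) U)"
  proof (rule seeds_disjoint_cliques[where Q = "\<lambda>k. {x k}" and J = "\<lambda>k. {..<M}" and
        F = "\<lambda>k j. {a\<in>core j. \<not> r (x k) a}"])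
    show "disjoint_family_on (\<lambda>k. {x k}) {..<t}"
      using x(1) by (auto simp: disjoint_family_on_def inj_on_def)
  qed (use bad_seed xB BU in auto)
  then show False using that BU[of 0] t by (simp add: insert_absorb)
qed

text \<open>
  Together with the \<open>t - 1\<close> bad vertices, a blue edge \<open>{y, z}\<close> serves as the last seed. Its clique takes
  no vertex from the core \<open>i\<close>.
\<close>

lemma extra_seed:
  assumes bad: "card bad = t - 1" and yz: "b y z" "y \<noteq> z" "{y, z} \<subseteq> insert v U" "{y, z} \<inter> bad = {}" and i: "i < M"
    and F: "\<And>j. j < M \<Longrightarrow> j \<noteq> i \<Longrightarrow> F j \<subseteq> core j \<and> (M + 1) * d + 2 * t * (M + 1) < card (F j)"
    and FQ: "\<And>j a. j < M \<Longrightarrow> j \<noteq> i \<Longrightarrow> a \<in> F j \<Longrightarrow> b a y \<and> b a z"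
  shows "disjoint_cliques b (M + 1) t (insert v U)"
proof -
  obtain x where x: "inj_on x {..<t - 1}" "x ` {..<t - 1} \<subseteq> bad"
    using inj_into[of "{..<t - 1}" bad] finU bad by (auto simp: bad_def)
  have xB: "x k \<in> bad" if "k < t - 1" for k using x that by auto
  have BU: "x k \<in> U" if "k < t - 1" for k using xB[OF that] by (auto simp: bad_def)
  have cases: "k < t - 1 \<or> k = t - 1" if "k < t" for k using that t by linarith
  show ?thesis
  proof (rule seeds_disjoint_cliques[where Q = "\<lambda>k. if k < t - 1 then {x k} else {y, z}"
        and J = "\<lambda>k. if k < t - 1 then {..<M} else {..<M} - {i}"
        and F = "\<lambda>k j. if k < t - 1 then {a\<in>core j. \<not> r (x k) a} else F j"])
    show "disjoint_family_on (\<lambda>k. if k < t - 1 then {x k} else {y, z}) {..<t}"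
      unfolding disjoint_family_on_def
    proof (intro ballI impI)
      fix k l assume kl: "k \<in> {..<t}" "l \<in> {..<t}" "k \<noteq> l"
      then consider "k < t - 1" "l < t - 1" | "k < t - 1" "\<not> l < t - 1" | "\<not> k < t - 1" "l < t - 1"
        using cases[of k] cases[of l] by auto
      then show "(if k < t - 1 then {x k} else {y, z}) \<inter> (if l < t - 1 then {x l} else {y, z}) = {}"
      proof cases
        case 1 then show ?thesis using x(1) kl by (auto simp: inj_on_def)
      qed (use xB yz in auto)
    qed
    fix k assume "k < t"
    show "finite (if k < t - 1 then {x k} else {y, z}) \<and> pairwise b (if k < t - 1 then {x k} else {y, z}) \<and>
      card (if k < t - 1 then {x k} else {y, z}) + card (if k < t - 1 then {..<M} else {..<M} - {i}) = M + 1 \<and>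
      (if k < t - 1 then {x k} else {y, z}) \<subseteq> insert v U"
      using BU yz i sympD[OF b] by (auto simp: pairwise_insert)
    show "(if k < t - 1 then {..<M} else {..<M} - {i}) \<subseteq> {..<M}" by auto
    fix j assume j: "j \<in> (if k < t - 1 then {..<M} else {..<M} - {i})"
    show "(if k < t - 1 then {a\<in>core j. \<not> r (x k) a} else F j) \<subseteq> core j \<and> (M + 1) * d + 2 * t * (M + 1)
      < card (if k < t - 1 then {a\<in>core j. \<not> r (x k) a} else F j)"
      using j bad_seed(1)[OF xB] F[of j] by (auto split: if_splits)
    fix a u assume "a \<in> (if k < t - 1 then {a\<in>core j. \<not> r (x k) a} else F j)"
      "u \<in> (if k < t - 1 then {x k} else {y, z})"
    then show "b a u" using j bad_seed(2)[OF xB] FQ[of j a] by (auto split: if_splits)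
  qed
qed

text \<open>
  \<open>M\<close> parts of at most \<open>n - 1\<close> vertices and at most \<open>t - 1\<close> bad vertices have to account for all
  \<open>(n - 1) * M + (t - 1)\<close> vertices.
\<close>

lemma card_parts_exact:
  assumes nc: "\<not> disjoint_cliques b (M + 1) t U"
  shows "card bad = t - 1" and "\<And>j. j < M \<Longrightarrow> card (part j) = n - 1"
proof -
  have "card U = card (\<Union>j<M. part j) + card bad"
    using part_subset finU unfolding bad_def
    by (subst card_Un_disjoint[symmetric]) (auto intro: finite_subset arg_cong[where f = card])
  moreover have "card (\<Union>j<M. part j) = (\<Sum>j<M. card (part j))"
    using part_disjoint finite_part by (intro card_UN_disjoint) auto
  ultimately have sum: "(n - 1) * M + (t - 1) = (\<Sum>j<M. card (part j)) + card bad" using card_U by simp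
  have bad: "card bad \<le> t - 1" using card_bad_less[OF nc] by simp
  have le: "(\<Sum>j<M. card (part j)) \<le> (\<Sum>j<M. n - 1)" using card_part_le by (intro sum_mono) auto
  then have le': "(\<Sum>j<M. card (part j)) \<le> (n - 1) * M" by (simp add: mult.commute)
  show "card bad = t - 1" using sum bad le' by linarith
  show "card (part j) = n - 1" if j: "j < M" for j
  proof (rule ccontr)
    assume "card (part j) \<noteq> n - 1"
    then have "card (part j) < n - 1" using card_part_le[OF j] by linarith
    then have "(\<Sum>j<M. card (part j)) < (\<Sum>j<M. n - 1)"
      using card_part_le j by (intro sum_strict_mono_ex1) auto
    then have "(\<Sum>j<M. card (part j)) < (n - 1) * M" by (simp add: mult.commute)
    then show False using sum bad by linarith
  qed
qed

text \<open>
  Two vertices of a part have few red neighbours in every other core, so a blue edge between them would be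
  an additional seed.
\<close>

lemma part_clique:
  assumes nc: "\<not> disjoint_cliques b (M + 1) t U" and i: "i < M"
  shows "pairwise r (part i)"
proof (rule pairwiseI, rule ccontr)
  fix w w' assume w: "w \<in> part i" "w' \<in> part i" "w \<noteq> w'" "\<not> r w w'"
  note cB = card_parts_exact(1)[OF nc] and cV = card_parts_exact(2)[OF nc]
  have wU: "w \<in> U" "w' \<in> U" using w part_subset[OF i] by auto
  let ?F = "\<lambda>j. {a\<in>core j. \<not> r w a \<and> \<not> r w' a}"
  have out: "w \<notin> part j" "w' \<notin> part j" if "j < M" "j \<noteq> i" for j using part_disjoint[OF i that(1)] that w by auto
  have "disjoint_cliques b (M + 1) t (insert w U)"
  proof (rule extra_seed[OF cB, where y = w and z = w' and i = i and F = ?F])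
    show "b w w'" using blue wU w by blast
    show "{w, w'} \<inter> bad = {}" using w i by (auto simp: bad_def)
    fix j assume j: "j < M" "j \<noteq> i"
    have "A j \<subseteq> ?F j \<union> ((\<Union>i<M. exceptional i) \<union> ({a\<in>A j. r w a} \<union> {a\<in>A j. r w' a}))" by (auto simp: core_def)
    then have "card (A j) \<le> card (?F j \<union> ((\<Union>i<M. exceptional i) \<union> ({a\<in>A j. r w a} \<union> {a\<in>A j. r w' a})))"
      using finite_A[OF j(1)] finite_exceptional finite_subset[OF core_subset finite_A[OF j(1)]] by (intro card_mono) simp_all
    also have "\<dots> \<le> card (?F j) + (card (\<Union>i<M. exceptional i) + (card {a\<in>A j. r w a} + card {a\<in>A j. r w' a}))"
      by (meson add_left_mono card_Un_le order_trans)
    finally have "card (A j) \<le> card (?F j) + (E + (card {a\<in>A j. r w a} + card {a\<in>A j. r w' a}))"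
      using card_exceptional by linarith
    then show "?F j \<subseteq> core j \<and> (M + 1) * d + 2 * t * (M + 1) < card (?F j)"
      using outside_red_degree[OF j(1) cV[OF j(1)] wU(1) out(1)[OF j]]
        outside_red_degree[OF j(1) cV[OF j(1)] wU(2) out(2)[OF j]] A[OF j(1)] n_bounds(5) d_bounds(2) by auto
    fix a assume a: "a \<in> ?F j"
    then have aA: "a \<in> A j" using core_subset by auto
    then have "a \<in> U" "a \<noteq> w" "a \<noteq> w'" using A[OF j(1)] out[OF j] by (auto simp: part_def)
    then show "b a w \<and> b a w'" using blue wU a sympD[OF b] by blast
  qed (use wU w i in auto)
  then show False using nc wU by (simp add: insert_absorb)
qed

text \<open>
  The vertex \<open>v\<close> has no red neighbour in any part, as that would complete the tree, and it has a neighbour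
  in each part, as it misses only \<open>n - 2\<close> vertices. A blue edge from \<open>v\<close> to the part \<open>i\<close> in
  which it misses most vertices is a seed: of any other part it misses at most half.
\<close>

lemma disjoint_cliques_with_vertex:
  assumes v: "v \<notin> U" and NB: "NB \<subseteq> U" "card (U - NB) \<le> n - 2"
    and vb: "\<And>x. x \<in> NB \<Longrightarrow> \<not> r v x \<Longrightarrow> b v x" and ne: "\<not> embeds p n r (insert v U)"
  shows "disjoint_cliques b (M + 1) t (insert v U)"
proof (rule ccontr)
  assume nc': "\<not> disjoint_cliques b (M + 1) t (insert v U)"
  then have nc: "\<not> disjoint_cliques b (M + 1) t U" using disjoint_cliques_mono by blast
  note cB = card_parts_exact(1)[OF nc] and cV = card_parts_exact(2)[OF nc]
  have nr: "\<not> r v x" if "j < M" "x \<in> part j" for j x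
  proof
    assume "r v x"
    then have "embeds p n r (insert v (part j))"
      using clique_pendant_embeds[OF p n_bounds(6) finite_part[OF that(1)] _ part_clique[OF nc that(1)] _ that(2)]
        cV[OF that(1)] v part_subset[OF that(1)] by auto
    then show False using ne embeds_mono[of p n r "insert v (part j)" "insert v U"] part_subset[OF that(1)] by blast
  qed
  define g where "g j = card (part j - NB)" for j
  have "Max (g ` {..<M}) \<in> g ` {..<M}" using M by (intro Max_in) (auto simp: lessThan_empty_iff)
  then obtain i where i: "i < M" "g i = Max (g ` {..<M})" by auto
  have gi: "g j \<le> g i" if "j < M" for j unfolding i(2) using that by (intro Max_ge) auto
  have half: "2 * g j \<le> n - 2" if j: "j < M" "j \<noteq> i" for j
  proof -
    have "g j + g i = card ((part j - NB) \<union> (part i - NB))"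
      unfolding g_def using part_disjoint[OF j(1) i(1) j(2)] finite_part j(1) i(1) by (intro card_Un_disjoint[symmetric]) auto
    also have "\<dots> \<le> card (U - NB)" using part_subset j(1) i(1) finU by (intro card_mono) auto
    finally show ?thesis using NB(2) gi[OF j(1)] by linarith
  qed
  have "\<not> part i \<subseteq> U - NB"
  proof
    assume "part i \<subseteq> U - NB"
    then have "card (part i) \<le> card (U - NB)" using finU by (intro card_mono) auto
    then show False using NB(2) cV[OF i(1)] n_bounds(6) by linarith
  qed
  then obtain w where w: "w \<in> part i" "w \<in> NB" using part_subset[OF i(1)] by blast
  have wU: "w \<in> U" using w NB by auto
  let ?F = "\<lambda>j. {a\<in>core j. a \<in> NB \<and> \<not> r w a}"
  have out: "w \<notin> part j" if "j < M" "j \<noteq> i" for j using part_disjoint[OF i(1) that(1)] that w by auto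
  have "disjoint_cliques b (M + 1) t (insert v U)"
  proof (rule extra_seed[OF cB, where y = v and z = w and i = i and F = ?F])
    show "b v w" using vb w nr i by blast
    show "{v, w} \<inter> bad = {}" using w i v by (auto simp: bad_def)
    fix j assume j: "j < M" "j \<noteq> i"
    have "A j \<subseteq> ?F j \<union> ((\<Union>i<M. exceptional i) \<union> ({a\<in>A j. r w a} \<union> (part j - NB)))" by (auto simp: core_def part_def)
    then have "card (A j) \<le> card (?F j \<union> ((\<Union>i<M. exceptional i) \<union> ({a\<in>A j. r w a} \<union> (part j - NB))))"
      using finite_A[OF j(1)] finite_part[OF j(1)] finite_exceptional finite_subset[OF core_subset finite_A[OF j(1)]] by (intro card_mono) simp_all
    also have "\<dots> \<le> card (?F j) + (card (\<Union>i<M. exceptional i) + (card {a\<in>A j. r w a} + g j))"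
      unfolding g_def by (meson add_left_mono card_Un_le order_trans)
    finally have "card (A j) \<le> card (?F j) + (E + (card {a\<in>A j. r w a} + g j))"
      using card_exceptional by linarith
    then show "?F j \<subseteq> core j \<and> (M + 1) * d + 2 * t * (M + 1) < card (?F j)"
      using outside_red_degree[OF j(1) cV[OF j(1)] wU out[OF j]] half[OF j]
        A[OF j(1)] n_bounds(5) d_bounds(2) by auto
    fix a assume a: "a \<in> ?F j"
    then have aA: "a \<in> A j" using core_subset by auto
    then have aV: "a \<in> part j" by (simp add: part_def)
    then have "a \<in> U" "a \<noteq> w" using part_subset[OF j(1)] out[OF j] by auto
    then have "b w a" using blue wU a by blast
    moreover have "b v a" using vb nr[OF j(1) aV] a by blast
    ultimately show "b a v \<and> b a w" using sympD[OF b] by blast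
  qed (use wU v i in auto)
  then show False using nc' by blast
qed

end

section \<open>Tree or disjoint blue cliques\<close>

text \<open>
  The vertex \<open>v\<close> is adjacent to \<open>NB\<close> only. Before stability is applied, fewer than \<open>t\<close> disjoint blue cliques
  are removed, which changes the size of \<open>U\<close> by a constant.
\<close>

lemma tree_or_disjoint_cliques:
  assumes M: "1 \<le> M" and t: "1 \<le> t"
  shows "\<exists>n0. \<forall>n\<ge>n0. \<forall>p (r :: 'v \<Rightarrow> 'v \<Rightarrow> bool) b U NB v. parent_fun p n \<and> symp r \<and> symp b \<and> finite U \<and>
    (\<forall>x\<in>U. \<forall>y\<in>U. x \<noteq> y \<longrightarrow> \<not> r x y \<longrightarrow> b x y) \<and> (\<forall>x\<in>NB. \<not> r v x \<longrightarrow> b v x) \<and> v \<notin> U \<and> NB \<subseteq> U \<and>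
    card U = (n - 1) * M + (t - 1) \<and> card (U - NB) \<le> n - 2 \<longrightarrow>
    embeds p n r (insert v U) \<or> disjoint_cliques b (M + 1) t (insert v U)"
proof -
  obtain C n0 where stab: "\<forall>n\<ge>n0. \<forall>p (r :: 'v \<Rightarrow> 'v \<Rightarrow> bool) U. parent_fun p n \<and> symp r \<and> finite U \<and>
     (n - 1) * M \<le> card U + t * (M + 1) \<and> \<not> embeds p n r U \<and>
     \<not> (\<exists>K\<subseteq>U. card K = M + 1 \<and> pairwise (\<lambda>x y. \<not> r x y) K) \<longrightarrow>
     (\<exists>A. (\<forall>j<M. A j \<subseteq> U \<and> pairwise r (A j) \<and> n \<le> card (A j) + C) \<and> disjoint_family_on A {..<M})"
    using clique_stability[of M "t * (M + 1)"] by (elim exE)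
  have "embeds p n r (insert v U) \<or> disjoint_cliques b (M + 1) t (insert v U)"
    if n: "n0 + order_bound M t C \<le> n" and p: "parent_fun p n" and r: "symp r" and b: "symp b" and U: "finite U"
      and blue: "\<forall>x\<in>U. \<forall>y\<in>U. x \<noteq> y \<longrightarrow> \<not> r x y \<longrightarrow> b x y" and vb: "\<forall>x\<in>NB. \<not> r v x \<longrightarrow> b v x"
      and v: "v \<notin> U" and NB: "NB \<subseteq> U" and cU: "card U = (n - 1) * M + (t - 1)" and cNB: "card (U - NB) \<le> n - 2"
    for n p v and r b :: "'v \<Rightarrow> 'v \<Rightarrow> bool" and U NB
  proof (rule ccontr)
    assume neg: "\<not> (embeds p n r (insert v U) \<or> disjoint_cliques b (M + 1) t (insert v U))"
    then have ne: "\<not> embeds p n r U" and nc: "\<not> disjoint_cliques b (M + 1) t U"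
      using embeds_mono[of p n r U "insert v U"] disjoint_cliques_mono[of b "M + 1" t U "insert v U"] by auto
    obtain U' where U': "U' \<subseteq> U" "card U \<le> card U' + t * (M + 1)"
      "\<not> (\<exists>K\<subseteq>U'. card K = M + 1 \<and> pairwise b K)"
      using remove_disjoint_cliques[OF U, of b "M + 1" t] nc by blast
    have "\<not> (\<exists>K\<subseteq>U'. card K = M + 1 \<and> pairwise (\<lambda>x y. \<not> r x y) K)"
    proof
      assume "\<exists>K\<subseteq>U'. card K = M + 1 \<and> pairwise (\<lambda>x y. \<not> r x y) K"
      then obtain K where K: "K \<subseteq> U'" "card K = M + 1" "pairwise (\<lambda>x y. \<not> r x y) K" by blast
      then have "pairwise b K" using blue U'(1) unfolding pairwise_def by blast
      then show False using K U'(3) by blast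
    qed
    moreover have "\<not> embeds p n r U'" using ne embeds_mono[OF _ U'(1)] by blast
    moreover have "finite U'" using U' U finite_subset by blast
    moreover have "(n - 1) * M \<le> card U' + t * (M + 1)" using cU U'(2) by linarith
    moreover have "n0 \<le> n" using n by simp
    ultimately have "\<exists>A. (\<forall>j<M. A j \<subseteq> U' \<and> pairwise r (A j) \<and> n \<le> card (A j) + C) \<and> disjoint_family_on A {..<M}"
      using stab[rule_format, of n p r U'] p r by blast
    then obtain A where A: "\<And>j. j < M \<Longrightarrow> A j \<subseteq> U' \<and> pairwise r (A j) \<and> n \<le> card (A j) + C"
      "disjoint_family_on A {..<M}" by blast
    interpret clique_system p n M t C r b U A
    proof
      show "A j \<subseteq> U \<and> pairwise r (A j) \<and> n \<le> card (A j) + C" if "j < M" for j using A(1)[OF that] U' by blast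
      show "order_bound M t C \<le> n" using n by simp
    qed (use p r b U blue ne cU A(2) t M in auto)
    show False using disjoint_cliques_with_vertex[OF v NB cNB] vb neg by blast
  qed
  then show ?thesis
    by (intro exI[of _ "n0 + order_bound M t C"] allI impI, elim conjE) assumption
qed

section \<open>From relations back to coloured graphs\<close>

text \<open>
  The graph obtained from \<open>K_N\<close> by making \<open>0\<close> non-adjacent to \<open>1, \<dots>, s\<close>.
\<close>

definition critical_graph :: "nat \<Rightarrow> nat \<Rightarrow> nat graph" where
  "critical_graph N s = remove_edges (complete_graph N) (star_graph s)"

lemma verts_critical: "verts (critical_graph N s) = {..<N}"
  by (simp add: critical_graph_def remove_edges_def complete_graph_def)

lemma edges_critical:
  "{x, y} \<in> edges (critical_graph N s) \<longleftrightarrow>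
   x \<noteq> y \<and> x < N \<and> y < N \<and> \<not> (x = 0 \<and> y \<le> s) \<and> \<not> (y = 0 \<and> x \<le> s)"
proof -
  have "{x, y} \<in> edges (star_graph s) \<longleftrightarrow> x \<noteq> y \<and> (x = 0 \<and> y \<le> s \<or> y = 0 \<and> x \<le> s)"
    by (auto simp: star_graph_def doubleton_eq_iff)
  moreover have "{x, y} \<in> edges (complete_graph N) \<longleftrightarrow> x \<noteq> y \<and> x < N \<and> y < N"
    by (auto simp: complete_graph_def nsets_def card_insert_if)
  ultimately show ?thesis unfolding critical_graph_def remove_edges_def by auto
qed

lemma mono_copy_tree:
  assumes T: "simple_graph T" and g: "bij_betw g {..<n} (verts T)"
    and e: "\<And>i j. i < n \<Longrightarrow> j < n \<Longrightarrow> {g i, g j} \<in> edges T \<longleftrightarrow> parent_edge p i j"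
    and emb: "embeds p n (\<lambda>x y. {x, y} \<in> edges G \<and> c {x, y} = k) (verts G)"
  shows "mono_copy G c k T"
proof -
  obtain \<phi> where \<phi>: "inj_on \<phi> {..<n}" "\<phi> ` {..<n} \<subseteq> verts G"
    "\<And>i. 0 < i \<Longrightarrow> i < n \<Longrightarrow> {\<phi> i, \<phi> (p i)} \<in> edges G \<and> c {\<phi> i, \<phi> (p i)} = k"
    using emb unfolding embeds_def by blast
  let ?h = "inv_into {..<n} g"
  have h: "bij_betw ?h (verts T) {..<n}" using g by (rule bij_betw_inv_into)
  have hn: "?h u < n" if "u \<in> verts T" for u using bij_betwE[OF h] that by auto
  have gh: "g (?h u) = u" if "u \<in> verts T" for u using g that by (simp add: bij_betw_inv_into_right)
  show ?thesis unfolding mono_copy_iff[OF T]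
  proof (intro exI[of _ "\<phi> \<circ> ?h"] conjI ballI impI)
    show "inj_on (\<phi> \<circ> ?h) (verts T)" using h \<phi>(1) by (simp add: bij_betw_def comp_inj_on)
    show "(\<phi> \<circ> ?h) ` verts T \<subseteq> verts G" using \<phi>(2) hn by auto
    fix u v assume uv: "u \<in> verts T" "v \<in> verts T" "{u, v} \<in> edges T"
    then have "parent_edge p (?h u) (?h v)" using e[of "?h u" "?h v"] hn gh by simp
    then have "{\<phi> (?h u), \<phi> (?h v)} \<in> edges G \<and> c {\<phi> (?h u), \<phi> (?h v)} = k"
      using \<phi>(3)[of "?h u"] \<phi>(3)[of "?h v"] hn uv unfolding parent_edge_def by (auto simp: insert_commute)
    then show "{(\<phi> \<circ> ?h) u, (\<phi> \<circ> ?h) v} \<in> edges G" "c {(\<phi> \<circ> ?h) u, (\<phi> \<circ> ?h) v} = k" by auto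
  qed
qed

lemma mono_copy_cliques:
  assumes dc: "disjoint_cliques (\<lambda>x y. {x, y} \<in> edges G \<and> c {x, y} = k) m t (verts G)" and m: "1 \<le> m"
  shows "mono_copy G c k (copies t (complete_graph m))"
proof -
  obtain R where R: "disjoint_family_on R {..<t}"
    "\<And>l. l < t \<Longrightarrow> R l \<subseteq> verts G \<and> card (R l) = m \<and>
      pairwise (\<lambda>x y. {x, y} \<in> edges G \<and> c {x, y} = k) (R l)"
    using dc unfolding disjoint_cliques_def by blast
  have "\<exists>h. bij_betw h {..<m} (R l)" if "l < t" for l
  proof -
    have "finite (R l)" using R(2)[OF that] m by (intro card_ge_0_finite) auto
    then show ?thesis using R(2)[OF that] by (intro finite_same_card_bij) auto
  qed
  then obtain h where h: "\<And>l. l < t \<Longrightarrow> bij_betw (h l) {..<m} (R l)" by metis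
  let ?f = "\<lambda>u. h (fst u) (snd u)"
  have hR: "h l x \<in> R l" if "l < t" "x < m" for l x using bij_betwE[OF h] that by auto
  have hinj: "h l x = h l y \<longleftrightarrow> x = y" if "l < t" "x < m" "y < m" for l x y
    using h[OF that(1)] that by (auto simp: bij_betw_def inj_on_def)
  show ?thesis unfolding mono_copy_iff[OF simple_copies_complete]
  proof (intro exI[of _ ?f] conjI ballI impI)
    show "inj_on ?f (verts (copies t (complete_graph m)))"
    proof (rule inj_onI)
      fix u v assume uv: "u \<in> verts (copies t (complete_graph m))" "v \<in> verts (copies t (complete_graph m))"
        and eq: "?f u = ?f v"
      then have lt: "fst u < t" "snd u < m" "fst v < t" "snd v < m" by (auto simp: verts_copies_complete)
      have "fst u = fst v"
      proof (rule ccontr)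
        assume "fst u \<noteq> fst v"
        then have "R (fst u) \<inter> R (fst v) = {}" using R(1) lt by (auto simp: disjoint_family_on_def)
        then show False using hR[OF lt(1,2)] hR[OF lt(3,4)] eq by auto
      qed
      moreover from this have "snd u = snd v" using hinj lt eq by auto
      ultimately show "u = v" by (simp add: prod_eq_iff)
    qed
    show "?f ` verts (copies t (complete_graph m)) \<subseteq> verts G"
      using hR R(2) by (fastforce simp: verts_copies_complete)
    fix u v assume "u \<in> verts (copies t (complete_graph m))" "v \<in> verts (copies t (complete_graph m))"
      "{u, v} \<in> edges (copies t (complete_graph m))"
    then have lt: "fst u < t" "fst u = fst v" "snd u < m" "snd v < m" and "u \<noteq> v"
      by (auto simp: edges_copies_complete)
    then have "snd u \<noteq> snd v" by (simp add: prod_eq_iff)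
    then have "?f u \<noteq> ?f v" using hinj lt by auto
    moreover have "?f u \<in> R (fst u)" "?f v \<in> R (fst u)" using hR lt by auto
    ultimately have "{?f u, ?f v} \<in> edges G \<and> c {?f u, ?f v} = k"
      using R(2)[OF lt(1)] unfolding pairwise_def by blast
    then show "{?f u, ?f v} \<in> edges G" "c {?f u, ?f v} = k" by auto
  qed
qed

section \<open>The extremal colouring\<close>

text \<open>
  The classes are \<open>{0, \<dots>, n - 1}\<close> and then consecutive blocks of \<open>n - 1\<close> vertices; the last
  \<open>t - 1\<close> vertices get class numbers \<open>\<ge> M\<close>. Vertex \<open>0\<close> is not adjacent to the rest of its class.
\<close>

lemma not_arrows_critical:
  assumes T: "tree T" "card (verts T) = n" and n: "2 \<le> n" and t: "1 \<le> t" and M: "1 \<le> M" and s: "n - 1 \<le> s"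
  shows "\<not> arrows (critical_graph ((n - 1) * M + t) s) T (copies t (complete_graph (M + 1)))"
proof -
  let ?N = "(n - 1) * M + t"
  let ?G = "critical_graph ?N s"
  \<comment> \<open>Truncated subtraction puts \<open>0\<close> into class \<open>0\<close>, next to \<open>1, \<dots>, n - 1\<close>.\<close>
  define cls where "cls x = (x - 1) div (n - 1)" for x :: nat
  define c where "c e = (if \<exists>j<M. \<forall>x\<in>e. cls x = j then Red else Blue)" for e
  have simT: "simple_graph T" using T by (simp add: tree_def)
  obtain g p where g: "bij_betw g {..<n} (verts T)" and p: "parent_fun p n"
    and pe: "\<And>i j. i < n \<Longrightarrow> j < n \<Longrightarrow> {g i, g j} \<in> edges T \<longleftrightarrow> parent_edge p i j"
    using tree_parent_fun[OF T] n by (metis One_nat_def Suc_1 Suc_leD)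
  have "\<not> mono_copy ?G c Red T"
  proof
    assume "mono_copy ?G c Red T"
    then obtain f where f: "inj_on f (verts T) \<and> f ` verts T \<subseteq> verts ?G \<and>
      (\<forall>u\<in>verts T. \<forall>v\<in>verts T. {u, v} \<in> edges T \<longrightarrow> {f u, f v} \<in> edges ?G \<and> c {f u, f v} = Red)"
      unfolding mono_copy_iff[OF simT] by (elim exE)
    let ?h = "\<lambda>i. f (g i)"
    have gV: "g i \<in> verts T" if "i < n" for i using bij_betwE[OF g] that by auto
    have red: "{?h i, ?h j} \<in> edges ?G \<and> cls (?h i) = cls (?h j) \<and> cls (?h i) < M"
      if ij: "i < n" "j < n" "parent_edge p i j" for i j
    proof -
      have "{?h i, ?h j} \<in> edges ?G \<and> c {?h i, ?h j} = Red" using f gV pe ij by blast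
      then show ?thesis by (auto simp: c_def split: if_splits)
    qed
    have par: "p i < n \<and> parent_edge p i (p i)" if "0 < i" "i < n" for i
      using p that by (fastforce simp: parent_fun_def parent_edge_def)
    have same: "cls (?h i) = cls (?h 0)" if "i < n" for i using that
    proof (induction i rule: less_induct)
      case (less i)
      show ?case
      proof (cases "i = 0")
        case False
        then have "p i < i" using p less.prems by (auto simp: parent_fun_def)
        then show ?thesis using less.IH[of "p i"] red[of i "p i"] par[of i] less.prems False by auto
      qed simp
    qed
    have nb: "\<exists>j<n. parent_edge p i j" if "i < n" for i
    proof (cases "i = 0")
      case True
      have "p 1 = 0" using p n by (auto simp: parent_fun_def)
      then show ?thesis using True n by (intro exI[of _ 1]) (auto simp: parent_edge_def)
    qed (use par that in blast)
    define j where "j = cls (?h 0)"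
    have jM: "j < M" using nb[of 0] red[of 0] n by (auto simp: j_def)
    have pos: "0 < ?h i" if i: "i < n" for i
    proof (rule ccontr)
      assume "\<not> 0 < ?h i"
      then have h0: "?h i = 0" by simp
      obtain l where l: "l < n" "parent_edge p i l" using nb[OF i] by blast
      have "cls (?h l) = 0" using red[OF i l] h0 by (simp add: cls_def)
      then have "?h l - 1 < n - 1" using n by (auto simp: cls_def div_eq_0_iff)
      then have "?h l \<le> s" using s by linarith
      then show False using red[OF i l] h0 by (simp add: edges_critical)
    qed
    have "?h ` {..<n} \<subseteq> {j * (n - 1) + 1 ..< j * (n - 1) + 1 + (n - 1)}"
    proof
      fix y assume "y \<in> ?h ` {..<n}"
      then obtain i where i: "i < n" "y = ?h i" by auto
      have dj: "(y - 1) div (n - 1) = j" and y: "0 < y"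
        using same[OF i(1)] pos[OF i(1)] i by (auto simp: j_def cls_def)
      have "j * (n - 1) \<le> y - 1"
        using div_times_less_eq_dividend[of "y - 1" "n - 1"] unfolding dj .
      moreover have "y - 1 < (n - 1) + j * (n - 1)"
        using dividend_less_div_times[of "n - 1" "y - 1"] n unfolding dj by simp
      ultimately show "y \<in> {j * (n - 1) + 1 ..< j * (n - 1) + 1 + (n - 1)}"
        using y n unfolding atLeastLessThan_iff by linarith
    qed
    then have "card (?h ` {..<n}) \<le> card {j * (n - 1) + 1 ..< j * (n - 1) + 1 + (n - 1)}" by (intro card_mono) auto
    moreover have "inj_on ?h {..<n}"
      using g f comp_inj_on[of g "{..<n}" f] by (auto simp: bij_betw_def comp_def)
    ultimately show False using n by (simp add: card_image)
  qed
  moreover have "\<not> mono_copy ?G c Blue (copies t (complete_graph (M + 1)))"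
  proof
    let ?K = "copies t (complete_graph (M + 1))"
    assume "mono_copy ?G c Blue ?K"
    then obtain f where f: "inj_on f (verts ?K) \<and> f ` verts ?K \<subseteq> verts ?G \<and>
      (\<forall>u\<in>verts ?K. \<forall>v\<in>verts ?K. {u, v} \<in> edges ?K \<longrightarrow> {f u, f v} \<in> edges ?G \<and> c {f u, f v} = Blue)"
      unfolding mono_copy_iff[OF simple_copies_complete] by (elim exE)
    have ex: "\<exists>x<M + 1. M \<le> cls (f (i, x))" if i: "i < t" for i
    proof (rule ccontr)
      assume no: "\<not> ?thesis"
      then have "(\<lambda>x. cls (f (i, x))) ` {..<M + 1} \<subseteq> {..<M}" by (auto simp: not_le)
      then have "card ((\<lambda>x. cls (f (i, x))) ` {..<M + 1}) \<le> M" using card_mono[of "{..<M}"] by fastforce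
      then have "\<not> inj_on (\<lambda>x. cls (f (i, x))) {..<M + 1}" using card_image by fastforce
      then obtain x y where xy: "x < M + 1" "y < M + 1" "x \<noteq> y" "cls (f (i, x)) = cls (f (i, y))"
        by (auto simp: inj_on_def)
      have "{(i, x), (i, y)} \<in> edges ?K" using xy i by (subst edges_copies_complete) auto
      moreover have "(i, x) \<in> verts ?K" "(i, y) \<in> verts ?K" using xy i by (auto simp: verts_copies_complete)
      ultimately have "c {f (i, x), f (i, y)} = Blue" using f by blast
      moreover have "cls (f (i, x)) < M" using no xy(1) by (auto simp: not_le)
      ultimately show False using xy(4) by (auto simp: c_def split: if_splits)
    qed
    then obtain x where x: "\<And>i. i < t \<Longrightarrow> x i < M + 1 \<and> M \<le> cls (f (i, x i))" by metis
    have xK: "(i, x i) \<in> verts ?K" if "i < t" for i using x[OF that] that by (auto simp: verts_copies_complete)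
    have "(\<lambda>i. f (i, x i)) ` {..<t} \<subseteq> {(n - 1) * M + 1 ..< ?N}"
    proof
      fix y assume "y \<in> (\<lambda>i. f (i, x i)) ` {..<t}"
      then obtain i where i: "i < t" "y = f (i, x i)" by auto
      have "y < ?N" using f xK[OF i(1)] i(2) by (auto simp: verts_critical)
      moreover have "M * (n - 1) \<le> y - 1"
        using x[OF i(1)] i(2) n by (simp add: cls_def less_eq_div_iff_mult_less_eq)
      moreover have "0 < y"
      proof (rule ccontr)
        assume "\<not> 0 < y"
        then have "M = 0" using x[OF i(1)] i(2) by (simp add: cls_def)
        then show False using M by simp
      qed
      ultimately show "y \<in> {(n - 1) * M + 1 ..< ?N}" by (simp add: mult.commute)
    qed
    then have "card ((\<lambda>i. f (i, x i)) ` {..<t}) \<le> card {(n - 1) * M + 1 ..< ?N}" by (intro card_mono) auto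
    moreover have "inj_on (\<lambda>i. f (i, x i)) {..<t}"
      using f xK unfolding inj_on_def by (metis Pair_inject lessThan_iff)
    ultimately show False using t by (simp add: card_image)
  qed
  ultimately show ?thesis unfolding arrows_def by blast
qed

section \<open>The star-critical Ramsey number\<close>

text \<open>
  Here \<open>v = 0\<close> and \<open>U = {1..<N}\<close>; removing \<open>n - 2\<close> edges at \<open>0\<close> leaves it adjacent to
  \<open>n - 1, \<dots>, N - 1\<close>.
\<close>

lemma arrows_critical:
  assumes m: "2 \<le> m" and t: "1 \<le> t"
  shows "\<exists>n0. \<forall>n\<ge>n0. \<forall>T :: 'a graph. tree T \<and> card (verts T) = n \<longrightarrow>
    arrows (critical_graph ((n - 1) * (m - 1) + t) (n - 2)) T (copies t (complete_graph m))"
proof -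
  have m1: "1 \<le> m - 1" "m - 1 + 1 = m" using m by auto
  obtain n0 where n0: "\<forall>n\<ge>n0. \<forall>p (r :: nat \<Rightarrow> nat \<Rightarrow> bool) b U NB v. parent_fun p n \<and> symp r \<and> symp b \<and> finite U \<and>
    (\<forall>x\<in>U. \<forall>y\<in>U. x \<noteq> y \<longrightarrow> \<not> r x y \<longrightarrow> b x y) \<and> (\<forall>x\<in>NB. \<not> r v x \<longrightarrow> b v x) \<and> v \<notin> U \<and> NB \<subseteq> U \<and>
    card U = (n - 1) * (m - 1) + (t - 1) \<and> card (U - NB) \<le> n - 2 \<longrightarrow>
    embeds p n r (insert v U) \<or> disjoint_cliques b m t (insert v U)"
    using tree_or_disjoint_cliques[OF m1(1) t, where 'v = nat] unfolding m1(2) by (elim exE)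
  have "arrows (critical_graph ((n - 1) * (m - 1) + t) (n - 2)) T (copies t (complete_graph m))"
    if n: "n0 + 2 \<le> n" and T: "tree T" "card (verts T) = n" for n and T :: "'a graph"
    unfolding arrows_def
  proof
    fix c
    define N where "N = (n - 1) * (m - 1) + t"
    let ?G = "critical_graph N (n - 2)"
    let ?r = "\<lambda>x y. {x, y} \<in> edges ?G \<and> c {x, y} = Red" and ?b = "\<lambda>x y. {x, y} \<in> edges ?G \<and> c {x, y} = Blue"
    obtain g p where g: "bij_betw g {..<n} (verts T)" and p: "parent_fun p n"
      and pe: "\<And>i j. i < n \<Longrightarrow> j < n \<Longrightarrow> {g i, g j} \<in> edges T \<longleftrightarrow> parent_edge p i j"
      using tree_parent_fun[OF T] n by (metis add_leD2 one_le_numeral order_trans)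
    have nn: "n0 \<le> n" using n by simp
    have N0: "0 < N" using t by (simp add: N_def)
    have colour: "c e \<noteq> Red \<Longrightarrow> c e = Blue" for e by (cases "c e") auto
    have ins: "insert 0 {1..<N} = verts ?G" using N0 by (auto simp: verts_critical)
    have "embeds p n ?r (insert 0 {1..<N}) \<or> disjoint_cliques ?b m t (insert 0 {1..<N})"
    proof (rule n0[THEN spec[of _ n], THEN mp, OF nn, THEN spec[of _ p], THEN spec[of _ ?r], THEN spec[of _ ?b],
          THEN spec[of _ "{1..<N}"], THEN spec[of _ "{max 1 (n - 1)..<N}"], THEN spec[of _ 0], THEN mp],
        intro conjI ballI impI)
      show "parent_fun p n" by (rule p)
      show "symp ?r" "symp ?b" by (auto simp: symp_def insert_commute)
      show "{x, y} \<in> edges ?G" if "x \<in> {1..<N}" "y \<in> {1..<N}" "x \<noteq> y" for x y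
        using that by (auto simp: edges_critical)
      show "c {x, y} = Blue" if "x \<in> {1..<N}" "y \<in> {1..<N}" "x \<noteq> y" "\<not> ?r x y" for x y
        using that colour by (auto simp: edges_critical)
      show "{0, x} \<in> edges ?G" if "x \<in> {max 1 (n - 1)..<N}" for x using that n by (auto simp: edges_critical)
      show "c {0, x} = Blue" if "x \<in> {max 1 (n - 1)..<N}" "\<not> ?r 0 x" for x
        using that n colour by (auto simp: edges_critical)
      show "card {1..<N} = (n - 1) * (m - 1) + (t - 1)" using t by (simp add: N_def)
      have "{1..<N} - {max 1 (n - 1)..<N} \<subseteq> {1..<n - 1}" using n by auto
      then have "card ({1..<N} - {max 1 (n - 1)..<N}) \<le> card {1..<n - 1}" by (intro card_mono) auto
      then show "card ({1..<N} - {max 1 (n - 1)..<N}) \<le> n - 2" by simp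
    qed auto
    then have "mono_copy ?G c Red T \<or> mono_copy ?G c Blue (copies t (complete_graph m))"
      unfolding ins
    proof
      assume "embeds p n ?r (verts ?G)"
      moreover have "simple_graph T" using T by (simp add: tree_def)
      ultimately have "mono_copy ?G c Red T" using g pe by (intro mono_copy_tree)
      then show ?thesis by (rule disjI1)
    next
      assume "disjoint_cliques ?b m t (verts ?G)"
      then have "mono_copy ?G c Blue (copies t (complete_graph m))"
        using m by (intro mono_copy_cliques) simp_all
      then show ?thesis by (rule disjI2)
    qed
    then show "mono_copy (critical_graph ((n - 1) * (m - 1) + t) (n - 2)) c Red T \<or>
      mono_copy (critical_graph ((n - 1) * (m - 1) + t) (n - 2)) c Blue (copies t (complete_graph m))"
      by (simp add: N_def)
  qed
  then show ?thesis by (intro exI[of _ "n0 + 2"] allI impI, elim conjE) assumption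
qed

theorem theorem1p5:
  fixes m t :: nat
  assumes "m \<ge> 2" and "t \<ge> 1"
  shows "\<exists>n0. \<forall>n\<ge>n0. \<forall>T :: 'a graph. tree T \<and> card (verts T) = n \<longrightarrow>
    star_critical_ramsey T (copies t (complete_graph m)) = (n - 1) * (m - 2) + t"
proof -
  obtain n0 where n0: "\<forall>n\<ge>n0. \<forall>T :: 'a graph. tree T \<and> card (verts T) = n \<longrightarrow>
    arrows (critical_graph ((n - 1) * (m - 1) + t) (n - 2)) T (copies t (complete_graph m))"
    using arrows_critical[OF assms] by (elim exE)
  have "star_critical_ramsey T (copies t (complete_graph m)) = (n - 1) * (m - 2) + t"
    if n: "n0 + 2 \<le> n" and T: "tree T" "card (verts T) = n" for n and T :: "'a graph"
  proof -
    define N where "N = (n - 1) * (m - 1) + t"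
    let ?K = "copies t (complete_graph m)"
    have simT: "simple_graph T" using T by (simp add: tree_def)
    have arr: "arrows (critical_graph N (n - 2)) T ?K"
      using n0[rule_format, of n T] n T unfolding N_def by simp
    have not_arr: "\<not> arrows (critical_graph N s) T ?K" if "n - 1 \<le> s" for s
    proof -
      have 2: "2 \<le> n" and M: "1 \<le> m - 1" and m: "m - 1 + 1 = m" using n assms(1) by auto
      from not_arrows_critical[OF T 2 assms(2) M that] show ?thesis unfolding N_def m .
    qed
    obtain m' where m': "m = Suc (Suc m')" using assms(1) by (metis add_2_eq_Suc le_Suc_ex)
    have Nk: "N = (n - 1) * (m - 2) + t + (n - 1)" by (simp add: N_def m')
    have rN: "ramsey_number T ?K = N" unfolding ramsey_number_def
    proof (rule Least_equality)
      show "arrows (complete_graph N) T ?K"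
        by (rule arrows_embed[OF arr simT simple_copies_complete, of id])
          (auto simp: verts_critical critical_graph_def remove_edges_def complete_graph_def)
      fix N' assume arr': "arrows (complete_graph N') T ?K"
      show "N \<le> N'"
      proof (rule ccontr)
        assume "\<not> N \<le> N'"
        then have less: "N' < N" by simp
        \<comment> \<open>Vertex \<open>0\<close> is isolated here, and the other vertices form a complete graph on \<open>N - 1 \<ge> N'\<close> vertices.\<close>
        have "arrows (critical_graph N (N - 1)) T ?K"
          by (rule arrows_embed[OF arr' simT simple_copies_complete, of Suc])
            (use less in \<open>auto simp: verts_critical edges_critical complete_graph_def nsets_def card_insert_if\<close>)
        moreover have "n - 1 \<le> N - 1" using Nk assms(2) by linarith
        ultimately show False using not_arr by blast
      qed
    qed
    show ?thesis unfolding star_critical_ramsey_def Let_def rN critical_graph_def[symmetric]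
    proof (rule Least_equality)
      have "N - 1 - ((n - 1) * (m - 2) + t) = n - 2" using Nk by simp
      then show "(n - 1) * (m - 2) + t \<le> N - 1 \<and>
        arrows (critical_graph N (N - 1 - ((n - 1) * (m - 2) + t))) T ?K"
        using arr Nk n by simp
      fix k assume k: "k \<le> N - 1 \<and> arrows (critical_graph N (N - 1 - k)) T ?K"
      show "(n - 1) * (m - 2) + t \<le> k"
      proof (rule ccontr)
        assume "\<not> (n - 1) * (m - 2) + t \<le> k"
        then have "n - 1 \<le> N - 1 - k" using Nk by linarith
        then show False using not_arr k by blast
      qed
    qed
  qed
  then show ?thesis by (intro exI[of _ "n0 + 2"] allI impI, elim conjE) assumption
qed

end
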